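(* For every integer $n\ge 2$ and every oriented tree $A$ on $n$ vertices, $$\operatorname{unvd}(A)\le\left\lceil\frac{18n-23}{7}\right\rceil .$$
   Context: A tournament is an orientation of a complete graph. An oriented tree is an orientation of an (undirected) tree. An oriented graph $D$ is $m$-unavoidable if every tournament on $m$ vertices contains a copy of $D$ (as a not necessarily induced subdigraph), and $\operatorname{unvd}(D)$ denotes the least $m$ such that $D$ is $m$-unavoidable. *)

theory Defs
  imports Complex_Main "Graph_Theory.Graph_Theory"
begin

text \<open>
  Undirected simple graphs are symmetric loop-free digraphs, as usual in Graph_Theory: an edge
  between \<open>u\<close> and \<open>v\<close> is the pair of opposite arcs. The constant \<^const>\<open>tree\<close> of that library is
  not the notion needed here: on a digraph it only forbids directed cycles, and on a symmetric
  digraph it also forbids the closed walk \<open>u, v, u\<close> along a single edge. In a symmetric loop-free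
  digraph, the cycles of length at least 3 are exactly the cycles of the undirected graph.
\<close>

definition undirected_tree :: "'a pair_pre_digraph \<Rightarrow> bool" where
  "undirected_tree G \<longleftrightarrow>
     pair_graph G \<and> connected (with_proj G) \<and>
     \<not> (\<exists>p. pre_digraph.cycle (with_proj G) p \<and> 3 \<le> length p)"

definition orientation :: "'a pair_pre_digraph \<Rightarrow> 'a pair_pre_digraph \<Rightarrow> bool" where
  "orientation D G \<longleftrightarrow>
     pair_digraph D \<and> (\<forall>u v. (u, v) \<in> parcs D \<longrightarrow> (v, u) \<notin> parcs D) \<and>
     mk_symmetric (with_proj D) = G"

definition oriented_tree :: "'a pair_pre_digraph \<Rightarrow> bool" where
  "oriented_tree A \<longleftrightarrow> (\<exists>G. undirected_tree G \<and> orientation A G)"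

definition tournament :: "nat \<Rightarrow> 'a pair_pre_digraph \<Rightarrow> bool" where
  "tournament m T \<longleftrightarrow> (\<exists>G. complete_digraph m (with_proj G) \<and> orientation T G)"

definition contains_copy :: "'b pair_pre_digraph \<Rightarrow> 'a pair_pre_digraph \<Rightarrow> bool" where
  "contains_copy T D \<longleftrightarrow> (\<exists>H. subgraph H (with_proj T) \<and> digraph_iso (with_proj D) H)"

text \<open>
  Quantifying over tournaments with vertices in \<^typ>\<open>nat\<close> loses nothing, since every finite
  tournament is isomorphic to one of these; see \<open>unavoidable_any_type\<close> below.
\<close>

definition unavoidable :: "nat \<Rightarrow> 'a pair_pre_digraph \<Rightarrow> bool" where
  "unavoidable m D \<longleftrightarrow> (\<forall>T :: nat pair_pre_digraph. tournament m T \<longrightarrow> contains_copy T D)"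

text \<open>
  The minimum exists precisely for the finite \<open>D\<close> without directed cycles, in particular for oriented
  trees; for other \<open>D\<close> the value is unspecified.
\<close>

definition unvd :: "'a pair_pre_digraph \<Rightarrow> nat" where
  "unvd D = (LEAST m. unavoidable m D)"

lemma contains_copy_iff:
  fixes T :: "'b pair_pre_digraph" and D :: "'a pair_pre_digraph"
  assumes D: "pair_wf_digraph D" and T: "pair_wf_digraph T"
  shows "contains_copy T D \<longleftrightarrow>
    (\<exists>f. inj_on f (pverts D) \<and> f ` pverts D \<subseteq> pverts T \<and>
         (\<forall>u v. (u, v) \<in> parcs D \<longrightarrow> (f u, f v) \<in> parcs T))"
proof
  interpret D: pair_wf_digraph D by (rule D)
  interpret T: pair_wf_digraph T by (rule T)
  have wD: "wf_digraph (with_proj D)" and wT: "wf_digraph (with_proj T)"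
    by unfold_locales
  {
    assume "contains_copy T D"
    then obtain h where sub: "subgraph (app_iso h (with_proj D)) (with_proj T)"
      and iso: "pre_digraph.digraph_isomorphism (with_proj D) h"
      unfolding contains_copy_def digraph_iso_def by auto
    have comp: "iso_tail h = fst" "iso_head h = snd"
      using sub by (auto simp: subgraph_def compatible_def app_iso_def)
    have "(iso_verts h u, iso_verts h v) \<in> parcs T" if "(u, v) \<in> parcs D" for u v
    proof -
      have "iso_verts h u = fst (iso_arcs h (u, v))" "iso_verts h v = snd (iso_arcs h (u, v))"
        using iso that comp unfolding pre_digraph.digraph_isomorphism_def by auto
      moreover have "iso_arcs h (u, v) \<in> parcs T"
        using sub that by (auto simp: subgraph_def app_iso_def)
      ultimately show ?thesis by simp
    qed
    moreover have "inj_on (iso_verts h) (pverts D)"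
      using iso unfolding pre_digraph.digraph_isomorphism_def by auto
    moreover have "iso_verts h ` pverts D \<subseteq> pverts T"
      using sub by (auto simp: subgraph_def app_iso_def)
    ultimately show "\<exists>f. inj_on f (pverts D) \<and> f ` pverts D \<subseteq> pverts T \<and>
         (\<forall>u v. (u, v) \<in> parcs D \<longrightarrow> (f u, f v) \<in> parcs T)" by blast
  }
  assume "\<exists>f. inj_on f (pverts D) \<and> f ` pverts D \<subseteq> pverts T \<and>
         (\<forall>u v. (u, v) \<in> parcs D \<longrightarrow> (f u, f v) \<in> parcs T)"
  then obtain f where f: "inj_on f (pverts D)" "f ` pverts D \<subseteq> pverts T"
    "\<And>u v. (u, v) \<in> parcs D \<Longrightarrow> (f u, f v) \<in> parcs T" by blast
  define h where "h = \<lparr> iso_verts = f, iso_arcs = map_prod f f,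
    iso_head = (snd :: 'b \<times> 'b \<Rightarrow> 'b), iso_tail = fst \<rparr>"
  have "inj_on (map_prod f f) (parcs D)"
    by (rule inj_on_subset[OF map_prod_inj_on[OF f(1) f(1)]])
       (auto dest: D.in_arcsD1 D.in_arcsD2)
  then have iso: "pre_digraph.digraph_isomorphism (with_proj D) h"
    using f(1) wD unfolding pre_digraph.digraph_isomorphism_def h_def by auto
  have "wf_digraph (app_iso h (with_proj D))"
    using wf_digraph.wf_digraphI_app_iso[OF wD iso] .
  then have "subgraph (app_iso h (with_proj D)) (with_proj T)"
    using f(2,3) wT by (auto simp: subgraph_def compatible_def app_iso_def h_def)
  then show "contains_copy T D"
    using iso unfolding contains_copy_def digraph_iso_def by blast
qed

lemma tournament_iff:
  "tournament m T \<longleftrightarrow> finite (pverts T) \<and> card (pverts T) = m \<and>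
     parcs T \<subseteq> pverts T \<times> pverts T \<and> (\<forall>u. (u, u) \<notin> parcs T) \<and>
     (\<forall>u\<in>pverts T. \<forall>v\<in>pverts T. u \<noteq> v \<longrightarrow> ((u, v) \<in> parcs T \<longleftrightarrow> (v, u) \<notin> parcs T))"
  (is "_ \<longleftrightarrow> ?R")
proof
  assume "tournament m T"
  then have c: "complete_digraph m (with_proj (mk_symmetric (with_proj T)))"
    and D: "pair_digraph T" and a: "\<And>u v. (u, v) \<in> parcs T \<Longrightarrow> (v, u) \<notin> parcs T"
    by (auto simp: tournament_def orientation_def)
  interpret pair_digraph T by (rule D)
  have E: "(\<Union>e\<in>parcs T. {(fst e, snd e), (snd e, fst e)}) =
      {(u, v). (u, v) \<in> pverts T \<times> pverts T \<and> u \<noteq> v}"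
    using c by (simp add: complete_digraph_pair_def mk_symmetric_def)
  have t: "(u, v) \<in> parcs T \<or> (v, u) \<in> parcs T"
    if "u \<in> pverts T" "v \<in> pverts T" "u \<noteq> v" for u v
  proof -
    have "(u, v) \<in> (\<Union>e\<in>parcs T. {(fst e, snd e), (snd e, fst e)})"
      unfolding E using that by simp
    then show ?thesis by auto
  qed
  have "card (pverts T) = m" "finite (pverts T)"
    using c by (simp_all add: complete_digraph_pair_def mk_symmetric_def)
  moreover have "(u, u) \<notin> parcs T" for u using a by blast
  moreover have "parcs T \<subseteq> pverts T \<times> pverts T" using in_arcsD1 in_arcsD2 by auto
  moreover have "(u, v) \<in> parcs T \<longleftrightarrow> (v, u) \<notin> parcs T"
    if "u \<in> pverts T" "v \<in> pverts T" "u \<noteq> v" for u v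
    using a t[OF that] by blast
  ultimately show ?R by (intro conjI ballI allI impI) assumption+
next
  assume R: ?R
  then have "finite (parcs T)" by (meson finite_SigmaI finite_subset)
  with R have "pair_digraph T" by unfold_locales auto
  moreover have "(v, u) \<notin> parcs T" if "(u, v) \<in> parcs T" for u v
  proof -
    have "u \<in> pverts T" "v \<in> pverts T" "u \<noteq> v" using R that by auto
    then show ?thesis using R that by blast
  qed
  moreover have "complete_digraph m (with_proj (mk_symmetric (with_proj T)))"
  proof -
    have "(\<Union>e\<in>parcs T. {(fst e, snd e), (snd e, fst e)}) =
      {(u, v). (u, v) \<in> parcs T \<or> (v, u) \<in> parcs T}"
      by force
    also have "\<dots> = {(u, v). (u, v) \<in> pverts T \<times> pverts T \<and> u \<noteq> v}"
      using R by auto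
    finally show ?thesis
      unfolding complete_digraph_pair_def using R by (simp add: mk_symmetric_def)
  qed
  ultimately show "tournament m T" unfolding tournament_def orientation_def by blast
qed

lemma unavoidable_any_type:
  fixes T :: "'b pair_pre_digraph" and D :: "'a pair_pre_digraph"
  assumes D: "pair_wf_digraph D" and un: "unavoidable m D" and T: "tournament m T"
  shows "contains_copy T D"
proof -
  have R: "finite (pverts T)" "card (pverts T) = m" "parcs T \<subseteq> pverts T \<times> pverts T"
    "\<forall>u. (u, u) \<notin> parcs T"
    "\<forall>u\<in>pverts T. \<forall>v\<in>pverts T. u \<noteq> v \<longrightarrow> ((u, v) \<in> parcs T \<longleftrightarrow> (v, u) \<notin> parcs T)"
    using T unfolding tournament_iff by - (elim conjE, assumption)+
  obtain g :: "nat \<Rightarrow> 'b" where g: "bij_betw g {0..<m} (pverts T)"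
    using ex_bij_betw_nat_finite[OF R(1)] R(2) by auto
  define N where "N = \<lparr> pverts = {0..<m},
    parcs = {(i, j). i < m \<and> j < m \<and> (g i, g j) \<in> parcs T} \<rparr>"
  have gi: "inj_on g {0..<m}" and gT: "\<And>i. i < m \<Longrightarrow> g i \<in> pverts T"
    using g by (auto simp: bij_betw_def)
  have N: "(g i, g j) \<in> parcs T \<longleftrightarrow> (g j, g i) \<notin> parcs T" if "i < m" "j < m" "i \<noteq> j" for i j
  proof -
    have "g i \<noteq> g j" using inj_onD[OF gi, of i j] that by auto
    then show ?thesis using R(5) gT that by blast
  qed
  have "tournament m N"
    unfolding tournament_iff
  proof (intro conjI ballI allI impI)
    fix i j assume "i \<in> pverts N" "j \<in> pverts N" "i \<noteq> j"
    then show "(i, j) \<in> parcs N \<longleftrightarrow> (j, i) \<notin> parcs N" using N[of i j] by (simp add: N_def)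
  qed (use R(4) in \<open>auto simp: N_def\<close>)
  then have "contains_copy N D" using un by (simp add: unavoidable_def)
  moreover have "pair_wf_digraph N" by unfold_locales (auto simp: N_def)
  ultimately obtain f where f: "inj_on f (pverts D)" "f ` pverts D \<subseteq> {0..<m}"
    "\<And>u v. (u, v) \<in> parcs D \<Longrightarrow> (f u, f v) \<in> parcs N"
    by (auto simp: contains_copy_iff[OF D] N_def)
  have "pair_wf_digraph T" using R(3) by unfold_locales auto
  moreover have "inj_on (g \<circ> f) (pverts D)"
    using f(1,2) gi by (meson comp_inj_on inj_on_subset)
  moreover have "(g \<circ> f) ` pverts D \<subseteq> pverts T" using f(2) gT by auto
  moreover have "((g \<circ> f) u, (g \<circ> f) v) \<in> parcs T" if "(u, v) \<in> parcs D" for u v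
    using f(3)[OF that] by (simp add: N_def)
  ultimately show ?thesis unfolding contains_copy_iff[OF D \<open>pair_wf_digraph T\<close>] by blast
qed

end

(*
  With \<sigma> = (4n - 3) div 14, every tournament on 2n - 2 + 2\<sigma> vertices contains the tree.

  Greedy growth along a median order: if the children of the node at position i are always placed on
  the first free out-neighbours of i, then the feedback property of the order charges every skipped
  position to a leaf. Growing in one direction b, with every component of arcs of the other
  direction placed as one block, embeds a rooted tree t in any tournament with at least cost b t - 1
  vertices.

  Cutting branches: call a vertex rich in a direction if its degree there is at least n - 1 + \<sigma>.
  In a tournament of the size above, every vertex is rich in some direction. Root the tree and call a
  branch small if, in it and in all its subbranches, the two monochromatic components at the root are
  short. Remove the small branches that hang by an arc of direction \<not> b from a vertex that stays.
  If the remaining core fits into the vertices rich in direction \<not> b, the removed branches can be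
  attached one component at a time, since each time the component fits into the free vertices rich
  in one of the two directions. The costs of the two cores add up to little more than 2n, so one of
  them fits. The only exception is a tree whose big branches form a path from the root; there the
  root can be moved along this path until the bound holds.
*)

theory Submission
  imports Defs "HOL-Library.Multiset"
begin

section \<open>Greedy growth along a median order\<close>

text \<open>Growth by itself does not suffice: a leaf costs 2 in either direction, and the star with
  \<open>p\<close> kids of each flag, on \<open>n = 2p + 1\<close> vertices, has cost
  \<open>3n - 4\<close> in both. A small branch that hangs from a vertex kept in both cores stays in
  only one of them, and there costs at most twice its size. What exceeds \<open>2n\<close> comes
  from the tree of big branches, and each leaf of that tree ties up \<open>\<sigma> + 2\<close>
  further vertices. The two degrees of a vertex sum to one less than the number of vertices, so
  \<open>2n - 2 + 2\<sigma>\<close> is the least number that forces one of them up to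
  \<open>n - 1 + \<sigma>\<close>. The excess \<open>\<sigma>\<close> over \<open>n - 1\<close> is
  the spare room when a branch \<open>c\<close> is attached: at least \<open>|c| + \<sigma>\<close>
  neighbours of its host are still free. The value of \<open>\<sigma>\<close> is the largest one for
  which \<open>2n - 2 + 2\<sigma>\<close> does not exceed the ceiling in the theorem.\<close>

lemma initial_subset:
  fixes S :: "nat set"
  assumes "finite S" "p \<le> card S"
  shows "\<exists>P\<subseteq>S. card P = p \<and> (\<forall>q\<in>S. \<forall>r\<in>P. q < r \<longrightarrow> q \<in> P)"
  using assms
proof (induction p)
  case 0
  then show ?case by (intro exI[of _ "{}"]) auto
next
  case (Suc p)
  have "\<exists>P\<subseteq>S. card P = p \<and> (\<forall>q\<in>S. \<forall>r\<in>P. q < r \<longrightarrow> q \<in> P)"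
    by (rule Suc.IH) (use Suc.prems in simp_all)
  then obtain P where P: "P \<subseteq> S" "card P = p" "\<forall>q\<in>S. \<forall>r\<in>P. q < r \<longrightarrow> q \<in> P" by blast
  have fP: "finite P" using P(1) Suc.prems(1) finite_subset by blast
  have "P \<noteq> S" using P(2) Suc.prems(2) by auto
  then have ne: "S - P \<noteq> {}" using P(1) by blast
  define x where "x = Min (S - P)"
  have x: "x \<in> S - P" "\<And>y. y \<in> S - P \<Longrightarrow> x \<le> y"
    unfolding x_def using Min_in[OF _ ne] Min_le[of "S - P"] Suc.prems(1) by blast+
  show ?case
  proof (intro exI conjI)
    show "insert x P \<subseteq> S" using x P by auto
    show "card (insert x P) = Suc p" using x P fP by auto
    show "\<forall>q\<in>S. \<forall>r\<in>insert x P. q < r \<longrightarrow> q \<in> insert x P"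
    proof (intro ballI impI)
      fix q r assume q: "q \<in> S" and r: "r \<in> insert x P" and "q < r"
      show "q \<in> insert x P"
      proof (rule ccontr)
        assume "q \<notin> insert x P"
        then have "r = x" using q r \<open>q < r\<close> P(3) by auto
        then show False using x(2)[of q] q \<open>q \<notin> insert x P\<close> \<open>q < r\<close> by auto
      qed
    qed
  qed
qed

text \<open>\<open>E i\<close> are the out-neighbours of position \<open>i\<close>, \<open>N0\<close> the nodes placed at the start and \<open>ch x\<close> the
  nodes placed as a group when position \<open>f x\<close> is reached; \<open>G0\<close> and \<open>G x\<close> are constraints within a
  group which every set of positions of the right size can satisfy.\<close>

locale growth =
  fixes m :: nat and E :: "nat \<Rightarrow> nat \<Rightarrow> bool"
    and N N0 :: "'n set" and ch :: "'n \<Rightarrow> 'n set"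
    and G0 :: "('n \<Rightarrow> nat) \<Rightarrow> bool" and G :: "'n \<Rightarrow> ('n \<Rightarrow> nat) \<Rightarrow> bool"
  assumes feedback: "\<And>i t. i < t \<Longrightarrow> t < m \<Longrightarrow> t - i \<le> 2 * card {q \<in> {i<..t}. E i q}"
    and finN: "finite N" and N0_ne: "N0 \<noteq> {}"
    and N_eq: "N = N0 \<union> (\<Union>x\<in>N. ch x)"
    and disj0: "\<And>x. x \<in> N \<Longrightarrow> ch x \<inter> N0 = {}"
    and disj: "\<And>x y. x \<in> N \<Longrightarrow> y \<in> N \<Longrightarrow> x \<noteq> y \<Longrightarrow> ch x \<inter> ch y = {}"
    and gen: "\<And>X. N0 \<subseteq> X \<Longrightarrow> X \<subseteq> N \<Longrightarrow> (\<And>x. x \<in> X \<Longrightarrow> ch x \<subseteq> X) \<Longrightarrow> X = N"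
    and bound: "card N + card N0 + (\<Sum>x\<in>N. card (ch x) - 1) \<le> m + 1"
    and G0_ex: "\<And>P. P \<subseteq> {..<m} \<Longrightarrow> card P = card N0 \<Longrightarrow> \<exists>g. bij_betw g N0 P \<and> G0 g"
    and G_ex: "\<And>x P. x \<in> N \<Longrightarrow> P \<subseteq> {..<m} \<Longrightarrow> card P = card (ch x) \<Longrightarrow> \<exists>g. bij_betw g (ch x) P \<and> G x g"
    and G0_cong: "\<And>g h. G0 g \<Longrightarrow> (\<And>c. c \<in> N0 \<Longrightarrow> h c = g c) \<Longrightarrow> G0 h"
    and G_cong: "\<And>x g h. x \<in> N \<Longrightarrow> G x g \<Longrightarrow> (\<And>c. c \<in> ch x \<Longrightarrow> h c = g c) \<Longrightarrow> G x h"
begin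

text \<open>The last conjunct records greediness: an out-neighbour of \<open>f x\<close> that lies
  before a child of \<open>x\<close> was passed over only because it was taken, by a node whose
  group was placed no later than that of \<open>x\<close>. The initial group fills the first
  positions, so a node lying beyond a skipped position always has a parent.\<close>

definition stage :: "nat \<Rightarrow> 'n set \<Rightarrow> ('n \<Rightarrow> nat) \<Rightarrow> bool" where
  "stage i X f \<longleftrightarrow> X \<subseteq> N \<and> inj_on f X \<and> f ` X \<subseteq> {..<m} \<and>
     X = N0 \<union> (\<Union>x\<in>{x\<in>X. f x < i}. ch x) \<and> f ` N0 = {..<card N0} \<and> G0 f \<and>
     (\<forall>x\<in>X. f x < i \<longrightarrow> G x f \<and> (\<forall>c\<in>ch x. f x < f c \<and> E (f x) (f c))) \<and>
     (\<forall>x\<in>X. f x < i \<longrightarrow> (\<forall>c\<in>ch x. \<forall>q. f x < q \<and> q < f c \<and> E (f x) q \<longrightarrow>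
        (\<exists>y\<in>X. f y = q \<and> (y \<in> N0 \<or> (\<exists>z\<in>X. y \<in> ch z \<and> f z \<le> f x)))))"

text \<open>While the embedding is incomplete, every skipped position is paid for by a leaf placed before it.\<close>

definition paid :: "nat \<Rightarrow> 'n set \<Rightarrow> ('n \<Rightarrow> nat) \<Rightarrow> bool" where
  "paid t X f \<longleftrightarrow> card {q. q < t \<and> q \<notin> f ` X} \<le> card {x\<in>X. f x < t \<and> ch x = {}}"

definition complete :: "('n \<Rightarrow> nat) \<Rightarrow> bool" where
  "complete f \<longleftrightarrow> inj_on f N \<and> f ` N \<subseteq> {..<m} \<and> G0 f \<and>
     (\<forall>x\<in>N. G x f \<and> (\<forall>c\<in>ch x. E (f x) (f c)))"

lemma N0_sub: "N0 \<subseteq> N" using N_eq by auto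
lemma ch_sub: "x \<in> N \<Longrightarrow> ch x \<subseteq> N" using N_eq by auto
lemma fin_ch: "x \<in> N \<Longrightarrow> finite (ch x)" using ch_sub finN finite_subset by blast

lemma stage_finished:
  assumes st: "stage i X f" and all: "\<And>x. x \<in> X \<Longrightarrow> f x < i"
  shows "complete f"
proof -
  have X: "X = N0 \<union> (\<Union>x\<in>{x\<in>X. f x < i}. ch x)" using st unfolding stage_def by blast
  have "X = N"
  proof (rule gen)
    show "N0 \<subseteq> X" using X by blast
    show "X \<subseteq> N" using st unfolding stage_def by blast
    show "ch x \<subseteq> X" if "x \<in> X" for x
      using X all[OF that] that by blast
  qed
  moreover have "inj_on f X" "f ` X \<subseteq> {..<m}" "G0 f"
    "\<forall>x\<in>X. f x < i \<longrightarrow> G x f \<and> (\<forall>c\<in>ch x. f x < f c \<and> E (f x) (f c))"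
    using st unfolding stage_def by - (elim conjE, assumption)+
  ultimately show ?thesis using all unfolding complete_def by simp
qed

lemma stage_init: "\<exists>f. stage 0 N0 f \<and> paid 0 N0 f"
proof -
  have c1: "card N0 \<ge> 1" using N0_ne N0_sub finN by (metis One_nat_def Suc_leI card_gt_0_iff finite_subset)
  have "card N0 \<le> card N" using N0_sub finN card_mono by blast
  then have "card N0 \<le> m" using c1 bound by linarith
  then obtain g where g: "bij_betw g N0 {..<card N0}" "G0 g"
    using G0_ex[of "{..<card N0}"] by auto
  have "stage 0 N0 g"
    using g N0_sub \<open>card N0 \<le> m\<close> unfolding stage_def bij_betw_def by auto
  moreover have "paid 0 N0 g" by (simp add: paid_def)
  ultimately show ?thesis by blast
qed

lemma card_stage:
  assumes st: "stage i X f"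
  shows "card X = card N0 + (\<Sum>x\<in>{x\<in>X. f x < i}. card (ch x))"
proof -
  let ?Y = "{x\<in>X. f x < i}"
  have XN: "X \<subseteq> N" and X: "X = N0 \<union> (\<Union>x\<in>?Y. ch x)" using st unfolding stage_def by blast+
  have fY: "finite ?Y" using XN finN by (metis (no_types, lifting) finite_subset mem_Collect_eq subsetI)
  have YN: "?Y \<subseteq> N" using XN by blast
  have "card (\<Union>x\<in>?Y. ch x) = (\<Sum>x\<in>?Y. card (ch x))"
  proof (rule card_UN_disjoint[OF fY])
    show "\<forall>y\<in>?Y. finite (ch y)" using YN fin_ch by blast
    show "\<forall>y\<in>?Y. \<forall>z\<in>?Y. y \<noteq> z \<longrightarrow> ch y \<inter> ch z = {}"
      using YN disj by (meson subsetD)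
  qed
  moreover have "card X = card N0 + card (\<Union>x\<in>?Y. ch x)"
  proof -
    have "N0 \<inter> (\<Union>x\<in>?Y. ch x) = {}" using disj0 YN by blast
    moreover have "finite N0" using N0_sub finN finite_subset by blast
    moreover have "finite (\<Union>x\<in>?Y. ch x)" using fY YN fin_ch by blast
    ultimately have "card (N0 \<union> (\<Union>x\<in>?Y. ch x)) = card N0 + card (\<Union>x\<in>?Y. ch x)"
      by (rule card_Un_disjoint[rotated 2])
    then show ?thesis using X by metis
  qed
  ultimately show ?thesis by simp
qed

text \<open>If too few vertices are free for the children of \<open>x\<close>, then feedback bounds the number of
  positions after \<open>x\<close>, and the paid positions before \<open>x\<close> contradict the bound on \<open>m\<close>.\<close>

lemma enough_free:
  assumes st: "stage i X f" and pd: "paid i X f" and im: "i < m"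
    and x: "x \<in> X" "f x = i" and chx: "ch x \<noteq> {}"
  shows "card (ch x) \<le> card {q. i < q \<and> q < m \<and> E i q \<and> q \<notin> f ` X}"
proof (rule ccontr)
  let ?U = "{q. i < q \<and> q < m \<and> E i q \<and> q \<notin> f ` X}"
  let ?p = "card (ch x)"
  assume "\<not> ?p \<le> card ?U"
  then have U: "card ?U + 1 \<le> ?p" by simp
  have XN: "X \<subseteq> N" and inj: "inj_on f X" and fX: "f ` X \<subseteq> {..<m}"
    and X: "X = N0 \<union> (\<Union>x\<in>{x\<in>X. f x < i}. ch x)"
    using st unfolding stage_def by blast+
  have finX: "finite X" using XN finN finite_subset by blast
  have xN: "x \<in> N" using x XN by blast
  define H where "H = {y\<in>X. i < f y}"
  define L where "L = {y\<in>X. f y < i \<and> ch y = {}}"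
  define Pn where "Pn = {y\<in>X. f y < i \<and> ch y \<noteq> {}}"
  have fins: "finite H" "finite L" "finite Pn" using finX by (auto simp: H_def L_def Pn_def)
  let ?O = "{q\<in>{i<..m-1}. E i q}"
  have "?O \<subseteq> ?U \<union> f ` H"
    using im x by (auto simp: H_def)
  then have "card ?O \<le> card (?U \<union> f ` H)" by (rule card_mono[rotated]) (use fins in auto)
  also have "\<dots> \<le> card ?U + card (f ` H)" by (rule card_Un_le)
  also have "\<dots> \<le> card ?U + card H" using card_image_le[OF fins(1)] by simp
  finally have O: "card ?O \<le> card ?U + card H" .
  have m1: "m - 1 - i \<le> 2 * card ?O"
  proof (cases "i < m - 1")
    case True
    then show ?thesis using feedback[of i "m-1"] by simp
  qed simp
  have "X = insert x (L \<union> Pn \<union> H)"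
    using x inj by (auto simp: H_def L_def Pn_def inj_on_def) (metis nat_neq_iff)
  moreover have "x \<notin> L \<union> Pn \<union> H" "L \<inter> Pn = {}" "(L \<union> Pn) \<inter> H = {}"
    using x by (auto simp: H_def L_def Pn_def)
  ultimately have cX: "card X = card L + card Pn + card H + 1"
    using fins by (simp add: card_Un_disjoint)
  have cX2: "card X = card N0 + (\<Sum>y\<in>{y\<in>X. f y < i}. card (ch y))" by (rule card_stage[OF st])
  have s1: "(\<Sum>y\<in>{y\<in>X. f y < i}. card (ch y)) = (\<Sum>y\<in>Pn. card (ch y))"
    by (rule sum.mono_neutral_right) (use finX in \<open>auto simp: Pn_def\<close>)
  have s2: "(\<Sum>y\<in>Pn. card (ch y)) = (\<Sum>y\<in>Pn. card (ch y) - 1) + card Pn"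
  proof -
    have "(\<Sum>y\<in>Pn. card (ch y)) = (\<Sum>y\<in>Pn. (card (ch y) - 1) + 1)"
    proof (rule sum.cong[OF refl])
      fix y assume "y \<in> Pn"
      then have "y \<in> N" "ch y \<noteq> {}" using XN by (auto simp: Pn_def)
      then have "card (ch y) > 0" using fin_ch card_gt_0_iff by blast
      then show "card (ch y) = (card (ch y) - 1) + 1" by simp
    qed
    also have "\<dots> = (\<Sum>y\<in>Pn. card (ch y) - 1) + card Pn" unfolding sum.distrib by simp
    finally show ?thesis .
  qed
  have "(\<Sum>y\<in>insert x Pn. card (ch y) - 1) \<le> (\<Sum>y\<in>N. card (ch y) - 1)"
    by (rule sum_mono2) (use finN XN xN in \<open>auto simp: Pn_def\<close>)
  moreover have "x \<notin> Pn" using x by (auto simp: Pn_def)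
  ultimately have s3: "(\<Sum>y\<in>Pn. card (ch y) - 1) + (?p - 1) \<le> (\<Sum>y\<in>N. card (ch y) - 1)"
    using fins by simp
  have p1: "?p \<ge> 1" using U by simp
  have "ch x \<inter> X = {}"
  proof -
    have "ch x \<inter> ch y = {}" if "y \<in> X" "f y < i" for y
      using disj[of x y] that x XN xN by blast
    then show ?thesis using disj0[OF xN] X by blast
  qed
  moreover have "ch x \<union> X \<subseteq> N" using ch_sub[OF xN] XN by blast
  ultimately have cN: "?p + card X \<le> card N"
    using card_mono[OF finN, of "ch x \<union> X"] card_Un_disjoint[of "ch x" X] fin_ch[OF xN] finX by simp
  let ?F = "{q. q < i \<and> q \<notin> f ` X}"
  have F: "card ?F \<le> card L" using pd by (simp add: paid_def L_def)
  have "{..<i} = ?F \<union> f ` (L \<union> Pn)" using im by (auto simp: L_def Pn_def)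
  then have "i \<le> card ?F + card (f ` (L \<union> Pn))"
    by (metis card_Un_le card_lessThan)
  also have "\<dots> \<le> card ?F + (card L + card Pn)"
    using card_image_le[of "L \<union> Pn" f] fins card_Un_le[of L Pn] by simp
  finally have i: "i \<le> card L + (card L + card Pn)" using F by simp
  \<comment> \<open>Feedback and the count of the positions before \<open>i\<close> give
    \<open>m + 3 \<le> 2p + 2|X| - |Pn|\<close> with \<open>p\<close> the size of
    \<open>ch x\<close>, whereas \<open>bound\<close> gives
    \<open>m + 2 \<ge> 2p + 2|X| - |Pn|\<close>.\<close>
  show False using O m1 cX cX2 s1 s2 s3 p1 cN i bound U im by linarith
qed

text \<open>Let \<open>j\<close> be the last position before \<open>i\<close> whose node has a child
  beyond \<open>i\<close>. By greediness the out-neighbours of \<open>j\<close> up to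
  \<open>i\<close> are all taken, by a set \<open>A\<close> of nodes placed no later than the
  children of that node; so feedback bounds the skipped positions in \<open>(j, i]\<close> by
  \<open>|A|\<close>. By the choice of \<open>j\<close>, every non-leaf between \<open>j\<close> and
  \<open>i\<close> has its children there as well, none of them in \<open>A\<close>. Hence
  \<open>|Nl| \<le> |Hs - A|\<close>, that is, \<open>|A| \<le> |Lf|\<close>. Up to \<open>j\<close>
  the hypothesis applies.\<close>

lemma paid_fail:
  assumes st: "stage i X f" and pd: "\<And>t. t \<le> i \<Longrightarrow> paid t X f" and im: "i < m"
    and fail: "i \<notin> f ` X" and pend: "y0 \<in> X" "i < f y0"
  shows "paid (Suc i) X f"
proof -
  have XN: "X \<subseteq> N" and inj: "inj_on f X" and fX: "f ` X \<subseteq> {..<m}"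
    and X: "X = N0 \<union> (\<Union>x\<in>{x\<in>X. f x < i}. ch x)" and N0: "f ` N0 = {..<card N0}"
    and up: "\<And>x c. x \<in> X \<Longrightarrow> f x < i \<Longrightarrow> c \<in> ch x \<Longrightarrow> f x < f c"
    and gr: "\<And>x c q. x \<in> X \<Longrightarrow> f x < i \<Longrightarrow> c \<in> ch x \<Longrightarrow> f x < q \<Longrightarrow> q < f c \<Longrightarrow> E (f x) q \<Longrightarrow>
        (\<exists>y\<in>X. f y = q \<and> (y \<in> N0 \<or> (\<exists>z\<in>X. y \<in> ch z \<and> f z \<le> f x)))"
    using st unfolding stage_def by blast+
  have finX: "finite X" using XN finN finite_subset by blast
  have "y0 \<notin> N0"
  proof
    assume "y0 \<in> N0"
    then have "f y0 < card N0" using N0 by blast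
    then have "i \<in> f ` N0" using N0 pend by auto
    then show False using fail X by blast
  qed
  then obtain z0 where z0: "z0 \<in> X" "f z0 < i" "y0 \<in> ch z0" using X pend by blast
  define J where "J = {f z |z. z \<in> X \<and> f z < i \<and> (\<exists>c\<in>ch z. i < f c)}"
  have finJ: "finite J" using finX by (auto simp: J_def)
  have "f z0 \<in> J" using z0 pend by (auto simp: J_def)
  define j where "j = Max J"
  have "j \<in> J" using finJ \<open>f z0 \<in> J\<close> unfolding j_def by (intro Max_in) auto
  have jmax: "\<And>k. k \<in> J \<Longrightarrow> k \<le> j" using finJ unfolding j_def by simp
  obtain z c where z: "z \<in> X" "f z = j" "j < i" "c \<in> ch z" "i < f c"
    using \<open>j \<in> J\<close> by (auto simp: J_def)
  let ?O = "{q\<in>{j<..i}. E j q}"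
  define A where "A = {y\<in>X. j < f y \<and> f y < i \<and> (y \<in> N0 \<or> (\<exists>z\<in>X. y \<in> ch z \<and> f z \<le> j))}"
  define Hs where "Hs = {y\<in>X. j < f y \<and> f y < i}"
  define Nl where "Nl = {y\<in>Hs. ch y \<noteq> {}}"
  define Lf where "Lf = {y\<in>Hs. ch y = {}}"
  have fins: "finite A" "finite Hs" "finite Nl" "finite Lf" using finX by (auto simp: A_def Hs_def Nl_def Lf_def)
  have OA: "?O \<subseteq> f ` A"
  proof
    fix q assume q: "q \<in> ?O"
    then obtain y where y: "y \<in> X" "f y = q" "y \<in> N0 \<or> (\<exists>z\<in>X. y \<in> ch z \<and> f z \<le> j)"
      using gr[OF z(1) _ z(4), of q] z by auto
    then have "q \<noteq> i" using fail by blast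
    then show "q \<in> f ` A" using y q by (auto simp: A_def)
  qed
  then have cOA: "card ?O \<le> card A" using fins(1) by (meson card_image_le card_mono finite_imageI le_trans)
  let ?F = "{q\<in>{j<..i}. q \<notin> f ` X}"
  have "?F \<subseteq> {j<..i} - ?O" using OA by (auto simp: A_def)
  then have "card ?F \<le> card ({j<..i} - ?O)" by (rule card_mono[rotated]) auto
  also have "\<dots> = (i - j) - card ?O" by (subst card_Diff_subset) auto
  finally have "card ?F \<le> card ?O" using feedback[of j i] z im by linarith
  have "card Nl \<le> card (Hs - A)"
  proof (rule card_inj_on_le[of "\<lambda>y. SOME c. c \<in> ch y"])
    have some: "(SOME c. c \<in> ch y) \<in> ch y" if "y \<in> Nl" for y
      using that by (auto simp: Nl_def some_in_eq)
    show "inj_on (\<lambda>y. SOME c. c \<in> ch y) Nl"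
    proof (rule inj_onI, rule ccontr)
      fix y y' assume y: "y \<in> Nl" "y' \<in> Nl" "(SOME c. c \<in> ch y) = (SOME c. c \<in> ch y')" "y \<noteq> y'"
      then have "y \<in> N" "y' \<in> N" using XN by (auto simp: Nl_def Hs_def)
      then show False using disj[of y y'] some[OF y(1)] some[OF y(2)] y by auto
    qed
    show "(\<lambda>y. SOME c. c \<in> ch y) ` Nl \<subseteq> Hs - A"
    proof (rule image_subsetI)
      fix y assume y: "y \<in> Nl"
      let ?c = "SOME c. c \<in> ch y"
      have yX: "y \<in> X" "j < f y" "f y < i" using y by (auto simp: Nl_def Hs_def)
      have c: "?c \<in> ch y" using some[OF y] .
      have cX: "?c \<in> X" using c yX X by blast
      have "f y < f ?c" using up yX c by blast
      moreover have "\<not> i < f ?c"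
      proof
        assume "i < f ?c"
        then have "f y \<in> J" using yX c by (auto simp: J_def)
        then show False using jmax yX by fastforce
      qed
      moreover have "f ?c \<noteq> i" using fail cX by blast
      ultimately have "?c \<in> Hs" using cX yX by (auto simp: Hs_def)
      moreover have "?c \<notin> A"
      proof
        assume "?c \<in> A"
        then consider "?c \<in> N0" | z where "z \<in> X" "?c \<in> ch z" "f z \<le> j" by (auto simp: A_def)
        then show False
        proof cases
          case 1
          then show ?thesis using disj0[of y] c yX XN by blast
        next
          case 2
          then have "z \<noteq> y" using yX by auto
          then show ?thesis using disj[of z y] 2 c yX XN by blast
        qed
      qed
      ultimately show "?c \<in> Hs - A" by blast
    qed
    show "finite (Hs - A)" using fins by blast
  qed
  moreover have "A \<subseteq> Hs" by (auto simp: A_def Hs_def)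
  then have "card (Hs - A) = card Hs - card A" "card A \<le> card Hs"
    using fins by (auto simp: card_Diff_subset card_mono)
  moreover have "card Hs = card Nl + card Lf"
  proof -
    have "Hs = Nl \<union> Lf" "Nl \<inter> Lf = {}" by (auto simp: Nl_def Lf_def)
    then show ?thesis using fins by (simp add: card_Un_disjoint)
  qed
  ultimately have "card A \<le> card Lf" by linarith
  then have FL: "card ?F \<le> card Lf" using cOA \<open>card ?F \<le> card ?O\<close> by linarith
  let ?Fa = "{q. q < Suc j \<and> q \<notin> f ` X}"
  let ?La = "{x\<in>X. f x < Suc j \<and> ch x = {}}"
  have dec: "t \<in> ?Fa \<union> ?F" if "t < Suc i" "t \<notin> f ` X" for t
  proof (cases "t < Suc j")
    case True
    then show ?thesis using that by simp
  next
    case False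
    then have "t \<in> {j<..i}" using that(1) by simp
    then show ?thesis using that(2) by simp
  qed
  have fF: "finite (?Fa \<union> ?F)" by simp
  have "card {q. q < Suc i \<and> q \<notin> f ` X} \<le> card (?Fa \<union> ?F)"
    by (rule card_mono[OF fF]) (use dec in blast)
  also have "\<dots> \<le> card ?Fa + card ?F" by (rule card_Un_le)
  also have "\<dots> \<le> card ?La + card Lf" using pd[of "Suc j"] z FL by (auto simp: paid_def)
  also have "\<dots> = card (?La \<union> Lf)"
    by (rule card_Un_disjoint[symmetric]) (use finX fins in \<open>auto simp: Lf_def Hs_def\<close>)
  also have "\<dots> \<le> card {x\<in>X. f x < Suc i \<and> ch x = {}}"
    by (rule card_mono) (use finX z in \<open>auto simp: Lf_def Hs_def\<close>)
  finally show ?thesis by (simp add: paid_def)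
qed

text \<open>A skipped position ends the growth if no node lies beyond it, and is paid for by
  \<open>paid_fail\<close> otherwise. At an occupied position the children go to the first free
  out-neighbours; they land beyond \<open>i\<close>, so no earlier count of skipped positions
  changes. All prefixes are kept paid because \<open>paid_fail\<close> falls back on an earlier
  one.\<close>

lemma stage_step:
  assumes st: "stage i X f" and pd: "\<And>t. t \<le> i \<Longrightarrow> paid t X f" and im: "i < m"
  shows "complete f \<or> (\<exists>X' f'. stage (Suc i) X' f' \<and> (\<forall>t\<le>Suc i. paid t X' f'))"
proof (cases "i \<in> f ` X")
  case False
  show ?thesis
  proof (cases "\<exists>y\<in>X. i < f y")
    case True
    then have "paid (Suc i) X f" using paid_fail[OF st pd im False] by blast
    then have "\<forall>t\<le>Suc i. paid t X f" using pd le_Suc_eq by auto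
    moreover have eq: "x \<in> X \<Longrightarrow> f x < Suc i \<longleftrightarrow> f x < i" for x using False by (auto simp: less_Suc_eq)
    then have "{x\<in>X. f x < Suc i} = {x\<in>X. f x < i}" by auto
    then have "stage (Suc i) X f" using st eq unfolding stage_def by simp
    ultimately show ?thesis by blast
  next
    case no: False
    have "x \<in> X \<Longrightarrow> f x < i" for x using no False by (metis imageI linorder_neqE_nat)
    then show ?thesis using stage_finished[OF st] by blast
  qed
next
  case True
  then obtain x where x: "x \<in> X" "f x = i" by blast
  have XN: "X \<subseteq> N" and inj: "inj_on f X" and fX: "f ` X \<subseteq> {..<m}"
    and X: "X = N0 \<union> (\<Union>x\<in>{x\<in>X. f x < i}. ch x)" and N0: "f ` N0 = {..<card N0}" and G0: "G0 f"
    and up: "\<And>x c. x \<in> X \<Longrightarrow> f x < i \<Longrightarrow> c \<in> ch x \<Longrightarrow> f x < f c \<and> E (f x) (f c)"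
    and Gf: "\<And>x. x \<in> X \<Longrightarrow> f x < i \<Longrightarrow> G x f"
    and gr: "\<And>x c q. x \<in> X \<Longrightarrow> f x < i \<Longrightarrow> c \<in> ch x \<Longrightarrow> f x < q \<Longrightarrow> q < f c \<Longrightarrow> E (f x) q \<Longrightarrow>
        (\<exists>y\<in>X. f y = q \<and> (y \<in> N0 \<or> (\<exists>z\<in>X. y \<in> ch z \<and> f z \<le> f x)))"
    using st unfolding stage_def by blast+
  have finX: "finite X" using XN finN finite_subset by blast
  have xN: "x \<in> N" using x XN by blast
  let ?U = "{q. i < q \<and> q < m \<and> E i q \<and> q \<notin> f ` X}"
  have "card (ch x) \<le> card ?U"
    using enough_free[OF st pd[OF order.refl] im x] by (cases "ch x = {}") auto
  then obtain P where P: "P \<subseteq> ?U" "card P = card (ch x)" "\<forall>q\<in>?U. \<forall>r\<in>P. q < r \<longrightarrow> q \<in> P"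
    using initial_subset[of ?U "card (ch x)"] by auto
  obtain g where g: "bij_betw g (ch x) P" "G x g" using G_ex[OF xN _ P(2)] P(1) by auto
  define f' where "f' = (\<lambda>y. if y \<in> ch x then g y else f y)"
  define X' where "X' = X \<union> ch x"
  have dX: "ch x \<inter> X = {}"
  proof -
    have "ch x \<inter> ch y = {}" if "y \<in> X" "f y < i" for y
      using disj[of x y] that x XN xN by blast
    then show ?thesis using disj0[OF xN] X by blast
  qed
  have old: "f' y = f y" if "y \<in> X" for y using that dX by (auto simp: f'_def)
  have new: "f' y = g y" if "y \<in> ch x" for y using that by (auto simp: f'_def)
  have gP: "g ` ch x = P" using g by (auto simp: bij_betw_def)
  have new_gt: "i < f' y" "f' y < m" "E i (f' y)" "f' y \<notin> f ` X" if "y \<in> ch x" for y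
    using that gP P(1) new by blast+
  have im': "f' ` X = f ` X" using old by auto
  have lt: "y \<in> X' \<and> f' y < Suc i \<longleftrightarrow> y \<in> X \<and> (f y < i \<or> y = x)" for y
  proof (cases "y \<in> X")
    case True
    then show ?thesis using old inj x by (auto simp: X'_def less_Suc_eq inj_on_def)
  next
    case False
    then show ?thesis using new_gt[of y] by (auto simp: X'_def)
  qed
  have chX: "ch y \<subseteq> X" if "y \<in> X" "f y < i" for y using that X by blast
  have N0X: "N0 \<subseteq> X" using X by blast
  have "stage (Suc i) X' f'"
    unfolding stage_def
  proof (intro conjI)
    show "X' \<subseteq> N" using XN ch_sub[OF xN] by (auto simp: X'_def)
    have "inj_on f' X" using inj old by (auto simp: inj_on_def)
    moreover have "inj_on f' (ch x)" using g new by (auto simp: inj_on_def bij_betw_def)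
    moreover have "f' ` (X - ch x) \<inter> f' ` (ch x - X) = {}"
    proof -
      have "f' u \<noteq> f' v" if "u \<in> X" "v \<in> ch x" for u v
        using new_gt(4)[OF that(2)] im' that(1) by (metis imageI)
      then show ?thesis by blast
    qed
    ultimately show "inj_on f' X'" unfolding X'_def inj_on_Un by blast
    show "f' ` X' \<subseteq> {..<m}" unfolding X'_def image_Un im' using fX new_gt(2) by blast
    have "{y\<in>X'. f' y < Suc i} = insert x {y\<in>X. f y < i}" using lt x(1) by blast
    then have "N0 \<union> (\<Union>y\<in>{y\<in>X'. f' y < Suc i}. ch y) = (N0 \<union> (\<Union>x\<in>{x\<in>X. f x < i}. ch x)) \<union> ch x" by auto
    then show "X' = N0 \<union> (\<Union>y\<in>{y\<in>X'. f' y < Suc i}. ch y)" using X by (simp add: X'_def)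
    show "f' ` N0 = {..<card N0}" using N0 old N0X by (metis image_cong subsetD)
    show "G0 f'" using G0_cong[OF G0] old N0X by blast
    show "\<forall>y\<in>X'. f' y < Suc i \<longrightarrow> G y f' \<and> (\<forall>c\<in>ch y. f' y < f' c \<and> E (f' y) (f' c))"
    proof (intro ballI impI)
      fix y assume "y \<in> X'" "f' y < Suc i"
      then have "y \<in> X \<and> (f y < i \<or> y = x)" using lt by blast
      then consider "y = x" | "y \<in> X" "f y < i" by blast
      then show "G y f' \<and> (\<forall>c\<in>ch y. f' y < f' c \<and> E (f' y) (f' c))"
      proof cases
        case 1
        then show ?thesis using G_cong[OF xN g(2)] new new_gt x old by auto
      next
        case 2
        then have "c \<in> ch y \<Longrightarrow> f' c = f c" for c using chX old by blast
        then show ?thesis using 2 G_cong[OF _ Gf[OF 2]] XN up[OF 2] old[OF 2(1)] by auto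
      qed
    qed
    show "\<forall>y\<in>X'. f' y < Suc i \<longrightarrow> (\<forall>c\<in>ch y. \<forall>q. f' y < q \<and> q < f' c \<and> E (f' y) q \<longrightarrow>
        (\<exists>y'\<in>X'. f' y' = q \<and> (y' \<in> N0 \<or> (\<exists>z\<in>X'. y' \<in> ch z \<and> f' z \<le> f' y))))"
    proof (intro ballI impI allI)
      fix y c q assume yX': "y \<in> X'" "f' y < Suc i" and c: "c \<in> ch y"
        and q: "f' y < q \<and> q < f' c \<and> E (f' y) q"
      then have "y \<in> X \<and> (f y < i \<or> y = x)" using lt by blast
      then consider "y = x" | "y \<in> X" "f y < i" by blast
      then show "\<exists>y'\<in>X'. f' y' = q \<and> (y' \<in> N0 \<or> (\<exists>z\<in>X'. y' \<in> ch z \<and> f' z \<le> f' y))"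
      proof cases
        case 1
        have fy: "f' y = i" using 1 old x by auto
        have q2: "i < q" "q < f' c" "E i q" "q < m" using q fy new_gt(2)[of c] c 1 by auto
        show ?thesis
        proof (cases "q \<in> f ` X")
          case True
          then obtain y' where y': "y' \<in> X" "f y' = q" by blast
          then have "y' \<in> N0 \<or> (\<exists>z\<in>X. y' \<in> ch z \<and> f z < i)" using X by blast
          then have "y' \<in> N0 \<or> (\<exists>z\<in>X'. y' \<in> ch z \<and> f' z \<le> f' y)"
            using old fy by (auto simp: X'_def)
          then show ?thesis using y' old by (auto simp: X'_def)
        next
          case False
          then have "q \<in> ?U" using q2 by blast
          moreover have "f' c \<in> P" using c 1 gP new by auto
          ultimately have "q \<in> P" using P(3) q2 by blast
          then obtain y' where "y' \<in> ch x" "g y' = q" using gP by blast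
          then show ?thesis using 1 new x by (intro bexI[of _ y']) (auto simp: X'_def)
        qed
      next
        case 2
        have "c \<in> X" using chX[OF 2] c by blast
        then obtain y' where "y'\<in>X" "f y' = q" "y' \<in> N0 \<or> (\<exists>z\<in>X. y' \<in> ch z \<and> f z \<le> f y)"
          using gr[OF 2 c, of q] q old 2(1) by auto
        then show ?thesis using old 2(1) by (intro bexI[of _ y']) (auto simp: X'_def)
      qed
    qed
  qed
  moreover have "paid t X' f'" if "t \<le> Suc i" for t
  proof -
    have "paid t X f"
    proof (cases "t = Suc i")
      case True
      have "{q. q < Suc i \<and> q \<notin> f ` X} = {q. q < i \<and> q \<notin> f ` X}"
        using x by (auto simp: less_Suc_eq)
      then have "card {q. q < Suc i \<and> q \<notin> f ` X} \<le> card {x \<in> X. f x < i \<and> ch x = {}}"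
        using pd[of i] by (simp add: paid_def)
      also have "\<dots> \<le> card {x \<in> X. f x < Suc i \<and> ch x = {}}"
        by (rule card_mono) (use finX in auto)
      finally show ?thesis using True by (simp add: paid_def)
    qed (use pd that in auto)
    moreover have "{q. q < t \<and> q \<notin> f' ` X'} = {q. q < t \<and> q \<notin> f ` X}"
      using im' new_gt(1) that unfolding X'_def image_Un by fastforce
    moreover have "card {x\<in>X. f x < t \<and> ch x = {}} \<le> card {x\<in>X'. f' x < t \<and> ch x = {}}"
      by (rule card_mono) (use finX fin_ch[OF xN] old in \<open>auto simp: X'_def\<close>)
    ultimately show ?thesis by (simp add: paid_def)
  qed
  ultimately show ?thesis by blast
qed

lemma growth: "\<exists>f. complete f"
proof -
  have "(\<exists>f. complete f) \<or> (\<exists>X f. stage i X f \<and> (\<forall>t\<le>i. paid t X f))" if "i \<le> m" for i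
    using that
  proof (induction i)
    case 0
    then show ?case using stage_init by auto
  next
    case (Suc i)
    then show ?case using stage_step[of i] by (meson Suc_leD Suc_le_lessD)
  qed
  from this[OF order.refl] show ?thesis
  proof
    assume "\<exists>X f. stage m X f \<and> (\<forall>t\<le>m. paid t X f)"
    then obtain X f where st: "stage m X f" by blast
    have "f ` X \<subseteq> {..<m}" using st unfolding stage_def by (elim conjE)
    then have "x \<in> X \<Longrightarrow> f x < m" for x by blast
    then have "complete f" using stage_finished[OF st] by blast
    then show ?thesis by blast
  qed
qed

end

section \<open>Tournaments and median orders\<close>

definition is_tournament :: "'v set \<Rightarrow> ('v \<Rightarrow> 'v \<Rightarrow> bool) \<Rightarrow> bool" where
  "is_tournament V E \<longleftrightarrow> finite V \<and> (\<forall>u\<in>V. \<forall>v\<in>V. E u v \<longrightarrow> \<not> E v u) \<and>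
     (\<forall>u\<in>V. \<forall>v\<in>V. u \<noteq> v \<longrightarrow> E u v \<or> E v u)"

lemma is_tournament_subset: "is_tournament V E \<Longrightarrow> W \<subseteq> V \<Longrightarrow> is_tournament W E"
  unfolding is_tournament_def by (blast intro: finite_subset)

text \<open>The number of arcs from an earlier to a later entry; a median order is an ordering that
  maximizes it.\<close>

fun forward :: "('v \<Rightarrow> 'v \<Rightarrow> bool) \<Rightarrow> 'v list \<Rightarrow> nat" where
  "forward E [] = 0"
| "forward E (x # xs) = length (filter (E x) xs) + forward E xs"

lemma forward_append:
  assumes "mset ys = mset zs"
  shows "forward E (xs @ ys) + forward E zs = forward E (xs @ zs) + forward E ys"
proof (induction xs)
  case (Cons x xs)
  have "length (filter (E x) ys) = length (filter (E x) zs)"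
    using assms by (metis mset_filter size_mset)
  then show ?case using Cons by simp
qed simp

text \<open>Only the arcs between \<open>v\<close> and \<open>ys\<close> change between forward and
  backward. The equation is written with sums since the difference may have either sign.\<close>

lemma forward_move:
  "forward E (v # ys @ zs) + length (filter (\<lambda>y. E y v) ys) =
   forward E (ys @ v # zs) + length (filter (E v) ys)"
proof (induction ys)
  case (Cons y ys)
  then show ?case by (cases "E v y"; cases "E y v") simp_all
qed simp

text \<open>If a vertex at position \<open>i\<close> had more in- than out-neighbours among the
  positions up to \<open>t\<close>, moving it right behind \<open>t\<close> would increase
  \<open>forward\<close>.\<close>

lemma median_order:
  assumes V: "is_tournament V E"
  obtains xs where "distinct xs" "set xs = V"
    "\<And>i t. i < t \<Longrightarrow> t < length xs \<Longrightarrow> t - i \<le> 2 * card {q \<in> {i<..t}. E (xs ! i) (xs ! q)}"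
proof -
  let ?S = "{xs. set xs = V \<and> distinct xs}"
  have finV: "finite V" using V by (simp add: is_tournament_def)
  have "finite ?S"
    by (rule finite_subset[OF _ finite_subset_distinct[OF finV]]) auto
  moreover have "?S \<noteq> {}" using finite_distinct_list[OF finV] by auto
  ultimately obtain xs where xs: "xs \<in> ?S" and mx: "\<And>ys. ys \<in> ?S \<Longrightarrow> forward E ys \<le> forward E xs"
    using Max_in[of "forward E ` ?S"] Max_ge[of "forward E ` ?S"] by (smt (verit) finite_imageI image_iff image_is_empty)
  have "t - i \<le> 2 * card {q \<in> {i<..t}. E (xs ! i) (xs ! q)}" if it: "i < t" "t < length xs" for i t
  proof -
    define ys where "ys = map ((!) xs) [Suc i..<Suc t]"
    define zs where "zs = drop (Suc t) xs"
    let ?v = "xs ! i"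
    have ys: "ys = take (t - i) (drop (Suc i) xs)"
      using it by (intro nth_equalityI) (auto simp: ys_def simp del: upt_Suc)
    have dec: "xs = take i xs @ ?v # ys @ zs"
    proof -
      have "drop (Suc i) xs = take (t - i) (drop (Suc i) xs) @ drop (t - i) (drop (Suc i) xs)"
        by (rule append_take_drop_id[symmetric])
      also have "drop (t - i) (drop (Suc i) xs) = zs" using it by (simp add: zs_def)
      finally have d: "drop (Suc i) xs = ys @ zs" unfolding ys .
      have "xs = take i xs @ ?v # drop (Suc i) xs" by (rule id_take_nth_drop) (use it in simp)
      then show ?thesis unfolding d .
    qed
    define as where "as = take i xs"
    have dec: "xs = as @ ?v # ys @ zs" using dec by (simp only: as_def)
    have sets: "set xs = V" "distinct xs" using xs by auto
    have mxs: "mset xs = mset (as @ ?v # ys @ zs)" using arg_cong[OF dec, of mset] .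
    have dxs: "distinct (as @ ?v # ys @ zs)" "set (as @ ?v # ys @ zs) = V"
      using sets arg_cong[OF dec, of distinct] arg_cong[OF dec, of set] by simp_all
    have "forward E (as @ ys @ ?v # zs) \<le> forward E xs"
    proof (rule mx)
      show "as @ ys @ ?v # zs \<in> ?S" using dxs by auto
    qed
    moreover have "forward E (as @ ys @ ?v # zs) + forward E (?v # ys @ zs) =
        forward E xs + forward E (ys @ ?v # zs)"
      using forward_append[of "ys @ ?v # zs" "?v # ys @ zs" E as] arg_cong[OF dec, of "forward E"] by simp
    ultimately have "forward E (ys @ ?v # zs) \<le> forward E (?v # ys @ zs)" by linarith
    then have le: "length (filter (\<lambda>y. E y ?v) ys) \<le> length (filter (E ?v) ys)"
      using forward_move[of E ?v ys zs] by linarith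
    have "E y ?v \<longleftrightarrow> \<not> E ?v y" if "y \<in> set ys" for y
    proof -
      have "y \<in> V" "?v \<in> V" "y \<noteq> ?v" using that dxs by auto
      then show ?thesis using V unfolding is_tournament_def by blast
    qed
    then have "filter (\<lambda>y. E y ?v) ys = filter (\<lambda>y. \<not> E ?v y) ys" by (intro filter_cong) auto
    then have "length ys \<le> 2 * length (filter (E ?v) ys)"
      using le sum_length_filter_compl[of "E ?v" ys] by simp
    moreover have "length ys = t - i" using it by (simp add: ys_def)
    moreover have "length (filter (E ?v) ys) = card {q \<in> {i<..t}. E ?v (xs ! q)}"
    proof -
      have "length (filter (E ?v) ys) = length (filter (\<lambda>q. E ?v (xs ! q)) [Suc i..<Suc t])"
        unfolding ys_def filter_map o_def by simp
      also have "\<dots> = card (set (filter (\<lambda>q. E ?v (xs ! q)) [Suc i..<Suc t]))"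
        by (rule distinct_card[symmetric]) simp
      also have "set (filter (\<lambda>q. E ?v (xs ! q)) [Suc i..<Suc t]) = {q \<in> {i<..t}. E ?v (xs ! q)}"
        by auto
      finally show ?thesis .
    qed
    ultimately show ?thesis by simp
  qed
  then show thesis using that xs by auto
qed

text \<open>Positions along a median order are traded for vertices. Since \<open>N0\<close> and the
  groups partition \<open>N\<close>, the sum in \<open>bound\<close> is the number of leaves minus
  \<open>card N0\<close>; so \<open>bound\<close> asks for as many vertices as \<open>N\<close> has
  nodes and leaves together, minus one.\<close>

lemma tournament_growth:
  fixes N N0 :: "'n set" and V :: "'v set"
  assumes V: "is_tournament V E" and finN: "finite N" and N0_ne: "N0 \<noteq> {}"
    and N_eq: "N = N0 \<union> (\<Union>x\<in>N. ch x)"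
    and disj0: "\<And>x. x \<in> N \<Longrightarrow> ch x \<inter> N0 = {}"
    and disj: "\<And>x y. x \<in> N \<Longrightarrow> y \<in> N \<Longrightarrow> x \<noteq> y \<Longrightarrow> ch x \<inter> ch y = {}"
    and gen: "\<And>X. N0 \<subseteq> X \<Longrightarrow> X \<subseteq> N \<Longrightarrow> (\<And>x. x \<in> X \<Longrightarrow> ch x \<subseteq> X) \<Longrightarrow> X = N"
    and bound: "card N + card N0 + (\<Sum>x\<in>N. card (ch x) - 1) \<le> card V + 1"
    and G0_ex: "\<And>P. P \<subseteq> V \<Longrightarrow> card P = card N0 \<Longrightarrow> \<exists>g. bij_betw g N0 P \<and> G0 g"
    and G_ex: "\<And>x P. x \<in> N \<Longrightarrow> P \<subseteq> V \<Longrightarrow> card P = card (ch x) \<Longrightarrow> \<exists>g. bij_betw g (ch x) P \<and> G x g"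
    and G0_cong: "\<And>g h. G0 g \<Longrightarrow> (\<And>c. c \<in> N0 \<Longrightarrow> h c = g c) \<Longrightarrow> G0 h"
    and G_cong: "\<And>x g h. x \<in> N \<Longrightarrow> G x g \<Longrightarrow> (\<And>c. c \<in> ch x \<Longrightarrow> h c = g c) \<Longrightarrow> G x h"
  obtains f where "inj_on f N" "f ` N \<subseteq> V" "G0 f" "\<And>x. x \<in> N \<Longrightarrow> G x f"
    "\<And>x c. x \<in> N \<Longrightarrow> c \<in> ch x \<Longrightarrow> E (f x) (f c)"
proof -
  obtain xs where xs: "distinct xs" "set xs = V"
    and fb: "\<And>i t. i < t \<Longrightarrow> t < length xs \<Longrightarrow> t - i \<le> 2 * card {q \<in> {i<..t}. E (xs ! i) (xs ! q)}"
    using median_order[OF V] by blast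
  let ?m = "length xs"
  have m: "?m = card V" using xs distinct_card by metis
  have bij: "bij_betw ((!) xs) {..<?m} V" using bij_betw_nth[OF xs(1)] xs(2) by blast
  have injp: "inj_on ((!) xs) {..<?m}" using bij by (simp add: bij_betw_def)
  define idx where "idx = inv_into {..<?m} ((!) xs)"
  have idx: "bij_betw idx ((!) xs ` P) P" "\<And>v. v \<in> (!) xs ` P \<Longrightarrow> xs ! idx v = v"
    if "P \<subseteq> {..<?m}" for P
  proof -
    have "idx (xs ! i) = i" if "i < ?m" for i
      unfolding idx_def using inv_into_f_f[OF injp, of i] that by simp
    then show "bij_betw idx ((!) xs ` P) P"
      using \<open>P \<subseteq> {..<?m}\<close> by (intro bij_betw_byWitness[where f' = "(!) xs"]) auto
    show "xs ! idx v = v" if "v \<in> (!) xs ` P" for v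
      unfolding idx_def using that \<open>P \<subseteq> {..<?m}\<close> by (intro f_inv_into_f) blast
  qed
  \<comment> \<open>A constraint on vertices is met on the image of \<open>P\<close> and pulled back
    by \<open>idx\<close>; the result agrees with the original map on \<open>C\<close> only, which
    is why \<open>cong\<close> is needed.\<close>
  have lift: "\<exists>g. bij_betw g C P \<and> H (\<lambda>c. xs ! g c)"
    if ex: "\<And>P. P \<subseteq> V \<Longrightarrow> card P = card C \<Longrightarrow> \<exists>g. bij_betw g C P \<and> H g"
      and cong: "\<And>g h. H g \<Longrightarrow> (\<And>c. c \<in> C \<Longrightarrow> h c = g c) \<Longrightarrow> H h"
      and P: "P \<subseteq> {..<?m}" "card P = card C" for C P and H :: "('n \<Rightarrow> 'v) \<Rightarrow> bool"
  proof -
    have "(!) xs ` P \<subseteq> V" using bij P by (auto simp: bij_betw_def)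
    moreover have "card ((!) xs ` P) = card C"
      using P card_image inj_on_subset[OF injp P(1)] by metis
    ultimately obtain g where g: "bij_betw g C ((!) xs ` P)" "H g" using ex by blast
    have "bij_betw (idx \<circ> g) C P" using bij_betw_trans[OF g(1) idx(1)[OF P(1)]] .
    moreover have "H (\<lambda>c. xs ! (idx \<circ> g) c)"
    proof (rule cong[OF g(2)])
      fix c assume "c \<in> C"
      then have "g c \<in> (!) xs ` P" using g(1) by (auto simp: bij_betw_def)
      then show "xs ! (idx \<circ> g) c = g c" using idx(2)[OF P(1)] by simp
    qed
    ultimately show ?thesis by blast
  qed
  interpret growth ?m "\<lambda>i j. E (xs ! i) (xs ! j)" N N0 ch "\<lambda>g. G0 (\<lambda>c. xs ! g c)" "\<lambda>x g. G x (\<lambda>c. xs ! g c)"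
  proof
    show "\<exists>g. bij_betw g N0 P \<and> G0 (\<lambda>c. xs ! g c)" if "P \<subseteq> {..<?m}" "card P = card N0" for P
      using lift[of N0 G0 P] G0_ex G0_cong that by blast
    show "\<exists>g. bij_betw g (ch x) P \<and> G x (\<lambda>c. xs ! g c)" if "x \<in> N" "P \<subseteq> {..<?m}" "card P = card (ch x)" for x P
      using lift[of "ch x" "G x" P] G_ex G_cong that by blast
  next
    fix g h :: "'n \<Rightarrow> nat" assume "G0 (\<lambda>c. xs ! g c)" "\<And>c. c \<in> N0 \<Longrightarrow> h c = g c"
    then show "G0 (\<lambda>c. xs ! h c)" using G0_cong[of "\<lambda>c. xs ! g c" "\<lambda>c. xs ! h c"] by simp
  next
    fix x and g h :: "'n \<Rightarrow> nat" assume "x \<in> N" "G x (\<lambda>c. xs ! g c)" "\<And>c. c \<in> ch x \<Longrightarrow> h c = g c"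
    then show "G x (\<lambda>c. xs ! h c)" using G_cong[of x "\<lambda>c. xs ! g c" "\<lambda>c. xs ! h c"] by simp
  qed (use fb finN N0_ne N_eq disj0 disj gen bound m in \<open>(assumption | simp)+\<close>)
  obtain f where f: "complete f" using growth by blast
  show thesis
  proof
    have f1: "inj_on f N" and f2: "f ` N \<subseteq> {..<?m}" using f by (simp_all add: complete_def)
    show "inj_on (\<lambda>x. xs ! f x) N"
      using comp_inj_on[OF f1 inj_on_subset[OF injp f2]] by (simp add: o_def)
    show "(\<lambda>x. xs ! f x) ` N \<subseteq> V" using f2 xs(2) by auto
  qed (use f in \<open>auto simp: complete_def\<close>)
qed

section \<open>Rooted oriented trees\<close>

text \<open>The flag of a kid is \<open>True\<close> if the arc leads from the parent to the kid.\<close>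

datatype 'a rt = Nd (lab: 'a) (kids: "(bool \<times> 'a rt) list")

lemma size_kid [termination_simp]:
  "k \<in> set ks \<Longrightarrow> size (snd k) < Suc (size_list (size_prod (\<lambda>_. 0) size) ks)"
proof -
  assume "k \<in> set ks"
  then have "size_prod (\<lambda>_. 0) size k \<le> size_list (size_prod (\<lambda>_. 0) size) ks"
    by (simp add: size_list_estimation')
  then show ?thesis by (cases k) simp
qed

lemma rt_induct [case_names Nd]:
  assumes "\<And>a ks. (\<And>k. k \<in> set ks \<Longrightarrow> P (snd k)) \<Longrightarrow> P (Nd a ks)"
  shows "P t"
proof (induction t)
  case (Nd a ks)
  show ?case
  proof (rule assms)
    fix k assume "k \<in> set ks"
    moreover have "snd k \<in> Basic_BNFs.snds k" by (cases k) simp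
    ultimately show "P (snd k)" by (rule Nd)
  qed
qed

fun labels :: "'a rt \<Rightarrow> 'a list" where
  "labels (Nd a ks) = a # concat (map (\<lambda>k. labels (snd k)) ks)"

fun subtrees :: "'a rt \<Rightarrow> 'a rt set" where
  "subtrees (Nd a ks) = insert (Nd a ks) (\<Union>k\<in>set ks. subtrees (snd k))"

definition kids_of :: "bool \<Rightarrow> 'a rt \<Rightarrow> 'a rt set" where
  "kids_of b t = {c. (b, c) \<in> set (kids t)}"

text \<open>The component of the root once the arcs of flag \<open>b\<close> are removed, an
  arborescence of arcs of flag \<open>\<not> b\<close>. A subtree stands for the vertex at its root,
  here and below; with distinct labels \<open>inj_lab\<close> justifies this.\<close>

fun block :: "bool \<Rightarrow> 'a rt \<Rightarrow> 'a rt set" where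
  "block b (Nd a ks) = insert (Nd a ks) (\<Union>k\<in>set ks. if fst k = b then {} else block b (snd k))"

text \<open>Each subtree \<open>s\<close> accounts for itself, for a possible skipped position if it has no kid of flag
  \<open>b\<close>, and for the \<open>2 (k - 1)\<close> positions lost when its \<open>k\<close> kids of flag \<open>\<not> b\<close> are placed in a block.\<close>

fun cost :: "bool \<Rightarrow> 'a rt \<Rightarrow> nat" where
  "cost b (Nd a ks) = 1 + (if \<exists>c. (b, c) \<in> set ks then 0 else 1) +
     2 * (length (filter (\<lambda>k. fst k \<noteq> b) ks) - 1) + (\<Sum>k\<leftarrow>ks. cost b (snd k))"

abbreviation dir :: "('v \<Rightarrow> 'v \<Rightarrow> bool) \<Rightarrow> bool \<Rightarrow> 'v \<Rightarrow> 'v \<Rightarrow> bool" where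
  "dir E b u v \<equiv> if b then E u v else E v u"

definition embeds :: "('v \<Rightarrow> 'v \<Rightarrow> bool) \<Rightarrow> ('a \<Rightarrow> 'v) \<Rightarrow> 'a rt \<Rightarrow> bool" where
  "embeds E f t \<longleftrightarrow> (\<forall>s\<in>subtrees t. \<forall>(b, c)\<in>set (kids s). dir E b (f (lab s)) (f (lab c)))"

lemma is_tournament_dir: "is_tournament V E \<Longrightarrow> is_tournament V (dir E b)"
  unfolding is_tournament_def by (cases b) auto

lemma subtrees_self: "t \<in> subtrees t" by (cases t) simp

lemma finite_subtrees: "finite (subtrees t)" by (induction t rule: rt_induct) auto

lemma lab_in_labels: "lab t \<in> set (labels t)" by (cases t) simp

lemma labels_subtrees: "set (labels t) = lab ` subtrees t"
proof (induction t rule: rt_induct)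
  case (Nd a ks)
  then show ?case by (auto simp: image_UN)
qed

lemma subtrees_trans: "s \<in> subtrees t \<Longrightarrow> subtrees s \<subseteq> subtrees t"
proof (induction t rule: rt_induct)
  case (Nd a ks)
  then show ?case by auto
qed

lemma kid_subtrees: "s \<in> subtrees t \<Longrightarrow> (b, c) \<in> set (kids s) \<Longrightarrow> c \<in> subtrees t"
proof -
  assume s: "s \<in> subtrees t" and c: "(b, c) \<in> set (kids s)"
  have "c \<in> subtrees s" using c subtrees_self[of c] by (cases s) force
  then show ?thesis using subtrees_trans[OF s] by blast
qed

lemma kids_of_subtrees: "s \<in> subtrees t \<Longrightarrow> c \<in> kids_of b s \<Longrightarrow> c \<in> subtrees t"
  unfolding kids_of_def using kid_subtrees by fast

lemma finite_kids_of: "finite (kids_of b t)"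
proof (rule finite_subset)
  show "kids_of b t \<subseteq> snd ` set (kids t)" by (force simp: kids_of_def)
qed simp

lemma distinct_kid: "distinct (labels (Nd a ks)) \<Longrightarrow> k \<in> set ks \<Longrightarrow> distinct (labels (snd k))"
proof -
  have "distinct (concat (map f ks)) \<Longrightarrow> k \<in> set ks \<Longrightarrow> distinct (f k)" for f :: "bool \<times> 'a rt \<Rightarrow> 'a list"
    by (induction ks) auto
  from this[of "\<lambda>k. labels (snd k)"]
  show "distinct (labels (Nd a ks)) \<Longrightarrow> k \<in> set ks \<Longrightarrow> distinct (labels (snd k))" by simp
qed

lemma distinct_sub: "s \<in> subtrees t \<Longrightarrow> distinct (labels t) \<Longrightarrow> distinct (labels s)"
proof (induction t rule: rt_induct)
  case (Nd a ks)
  then show ?case using distinct_kid by fastforce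
qed

lemma distinct_kids:
  assumes "distinct (concat (map (\<lambda>k. labels (snd k)) ks))"
  shows "distinct (map snd ks)"
    and "k \<in> set ks \<Longrightarrow> k' \<in> set ks \<Longrightarrow> x \<in> set (labels (snd k)) \<Longrightarrow> x \<in> set (labels (snd k')) \<Longrightarrow> k = k'"
proof -
  have "distinct (map snd ks) \<and> (\<forall>k\<in>set ks. \<forall>k'\<in>set ks. \<forall>x\<in>set (labels (snd k)). x \<in> set (labels (snd k')) \<longrightarrow> k = k')"
    using assms
  proof (induction ks)
    case (Cons k ks)
    have "snd k \<notin> snd ` set ks"
    proof
      assume "snd k \<in> snd ` set ks"
      then obtain k' where "k' \<in> set ks" "snd k' = snd k" by auto
      then have "lab (snd k) \<in> set (labels (snd k)) \<inter> (\<Union>k\<in>set ks. set (labels (snd k)))"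
        using lab_in_labels[of "snd k"] by (metis IntI UN_I)
      then show False using Cons.prems by auto
    qed
    then show ?case using Cons by auto
  qed simp
  then show "distinct (map snd ks)"
    "k \<in> set ks \<Longrightarrow> k' \<in> set ks \<Longrightarrow> x \<in> set (labels (snd k)) \<Longrightarrow> x \<in> set (labels (snd k')) \<Longrightarrow> k = k'"
    by blast+
qed

lemma subtrees_disjoint:
  assumes "distinct (labels (Nd a ks))" "k \<in> set ks" "k' \<in> set ks" "s \<in> subtrees (snd k)" "s \<in> subtrees (snd k')"
  shows "k = k'"
proof -
  have "lab s \<in> set (labels (snd k))" "lab s \<in> set (labels (snd k'))"
    unfolding labels_subtrees using assms by blast+
  then show ?thesis using distinct_kids(2)[of ks k k' "lab s"] assms by simp
qed

lemma root_notin: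
  assumes "distinct (labels (Nd a ks))" "k \<in> set ks"
  shows "Nd a ks \<notin> subtrees (snd k)"
proof
  assume "Nd a ks \<in> subtrees (snd k)"
  then have "a \<in> set (labels (snd k))" unfolding labels_subtrees by force
  then show False using assms by auto
qed

lemma inj_lab: "distinct (labels t) \<Longrightarrow> inj_on lab (subtrees t)"
proof (induction t rule: rt_induct)
  case (Nd a ks)
  have r: "lab s \<noteq> a" if "k \<in> set ks" "s \<in> subtrees (snd k)" for k s
  proof -
    have "lab s \<in> set (labels (snd k))" unfolding labels_subtrees using that(2) by (rule imageI)
    moreover have "a \<notin> set (labels (snd k))" using Nd.prems that(1) by simp
    ultimately show ?thesis by metis
  qed
  show ?case
  proof (rule inj_onI)
    fix s s' assume s: "s \<in> subtrees (Nd a ks)" "s' \<in> subtrees (Nd a ks)" "lab s = lab s'"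
    show "s = s'"
    proof (cases "s = Nd a ks \<or> s' = Nd a ks")
      case True
      have eq: "u = Nd a ks" if "u \<in> subtrees (Nd a ks)" "lab u = a" for u
        using that r unfolding subtrees.simps by blast
      show ?thesis using True eq[OF s(1)] eq[OF s(2)] s(3) by (metis rt.sel(1))
    next
      case False
      then obtain k k' where k: "k \<in> set ks" "s \<in> subtrees (snd k)" "k' \<in> set ks" "s' \<in> subtrees (snd k')"
        using s by auto
      have "lab s \<in> set (labels (snd k))" unfolding labels_subtrees using k(2) by (rule imageI)
      moreover have "lab s \<in> set (labels (snd k'))" unfolding labels_subtrees s(3) using k(4) by (rule imageI)
      ultimately have "k = k'" using distinct_kids(2)[of ks k k' "lab s"] Nd.prems k by simp
      then show ?thesis using Nd.IH[OF k(1) distinct_kid[OF Nd.prems k(1)]] k s(3) by (auto dest: inj_onD)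
    qed
  qed
qed

lemma block_self: "t \<in> block b t" by (cases t) simp

lemma block_subtrees: "block b t \<subseteq> subtrees t"
proof (induction t rule: rt_induct)
  case (Nd a ks)
  then show ?case by (auto split: if_splits)
qed

lemma block_step: "s \<in> block b t \<Longrightarrow> (\<not> b, c) \<in> set (kids s) \<Longrightarrow> block b c \<subseteq> block b t"
proof (induction t rule: rt_induct)
  case (Nd a ks)
  show ?case
  proof (cases "s = Nd a ks")
    case True
    then have "(\<not> b, c) \<in> set ks" using Nd.prems by simp
    from UN_upper[OF this, of "\<lambda>k. if fst k = b then {} else block b (snd k)"] show ?thesis by auto
  next
    case False
    then obtain k where k: "k \<in> set ks" "fst k \<noteq> b" "s \<in> block b (snd k)"
      using Nd.prems by (auto split: if_splits)
    then have "block b c \<subseteq> block b (snd k)" using Nd.IH[of k] Nd.prems by blast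
    then show ?thesis using k UN_upper[OF k(1), of "\<lambda>k. if fst k = b then {} else block b (snd k)"] by auto
  qed
qed

lemma sum_list_UN:
  assumes "distinct ks" "\<And>k. k \<in> set ks \<Longrightarrow> finite (A k)"
    and "\<And>k k'. k \<in> set ks \<Longrightarrow> k' \<in> set ks \<Longrightarrow> k \<noteq> k' \<Longrightarrow> A k \<inter> A k' = {}"
  shows "sum F (\<Union>k\<in>set ks. A k) = (\<Sum>k\<leftarrow>ks. sum F (A k))"
  using assms
proof (induction ks)
  case (Cons k ks)
  have "A k \<inter> (\<Union>k\<in>set ks. A k) = {}" using Cons.prems by fastforce
  then have "sum F (\<Union>k\<in>set (k # ks). A k) = sum F (A k) + sum F (\<Union>k\<in>set ks. A k)"
    using Cons.prems(2) by (simp add: sum.union_disjoint)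
  then show ?case using Cons by simp
qed simp

lemma distinct_ks: "distinct (labels (Nd a ks)) \<Longrightarrow> distinct ks"
  using distinct_kids(1)[of ks] by (simp add: distinct_map)

lemma sum_subtrees:
  fixes F :: "'a rt \<Rightarrow> nat"
  assumes "distinct (labels (Nd a ks))"
  shows "sum F (subtrees (Nd a ks)) = F (Nd a ks) + (\<Sum>k\<leftarrow>ks. sum F (subtrees (snd k)))"
proof -
  have "sum F (\<Union>k\<in>set ks. subtrees (snd k)) = (\<Sum>k\<leftarrow>ks. sum F (subtrees (snd k)))"
    by (rule sum_list_UN) (use distinct_ks[OF assms] finite_subtrees subtrees_disjoint[OF assms] in blast)+
  moreover have "Nd a ks \<notin> (\<Union>k\<in>set ks. subtrees (snd k))" using root_notin[OF assms] by blast
  ultimately show ?thesis by (simp add: finite_subtrees)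
qed

lemma sum_block:
  fixes F :: "'a rt \<Rightarrow> nat"
  assumes "distinct (labels (Nd a ks))"
  shows "sum F (block b (Nd a ks)) = F (Nd a ks) + (\<Sum>k\<leftarrow>ks. if fst k = b then 0 else sum F (block b (snd k)))"
proof -
  have "sum F (\<Union>k\<in>set ks. if fst k = b then {} else block b (snd k)) =
      (\<Sum>k\<leftarrow>ks. sum F (if fst k = b then {} else block b (snd k)))"
  proof (rule sum_list_UN[OF distinct_ks[OF assms]])
    show "finite (if fst k = b then {} else block b (snd k))" for k
      using finite_subset[OF block_subtrees finite_subtrees] by auto
    show "(if fst k = b then {} else block b (snd k)) \<inter> (if fst k' = b then {} else block b (snd k')) = {}"
      if "k \<in> set ks" "k' \<in> set ks" "k \<noteq> k'" for k k'
      using subtrees_disjoint[OF assms that(1,2)] that(3) block_subtrees[of b "snd k"] block_subtrees[of b "snd k'"] by auto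
  qed
  moreover have "(\<lambda>k. sum F (if fst k = b then {} else block b (snd k))) =
      (\<lambda>k. if fst k = b then 0 else sum F (block b (snd k)))" by auto
  moreover have "Nd a ks \<notin> (\<Union>k\<in>set ks. if fst k = b then {} else block b (snd k))"
    using root_notin[OF assms] block_subtrees by (fastforce split: if_splits)
  moreover have "finite (\<Union>k\<in>set ks. if fst k = b then {} else block b (snd k))"
    using finite_subset[OF block_subtrees finite_subtrees] by auto
  ultimately show ?thesis by simp
qed

lemma parent_unique:
  assumes "distinct (labels t)" "s \<in> subtrees t" "s' \<in> subtrees t" "(b, c) \<in> set (kids s)" "(b', c) \<in> set (kids s')"
  shows "s = s' \<and> b = b'"
  using assms
proof (induction t rule: rt_induct)
  case (Nd a ks)
  have top: "s1 = s2 \<and> b1 = b2"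
    if t: "s1 = Nd a ks" "s2 \<in> subtrees (Nd a ks)" "(b1, c) \<in> set (kids s1)" "(b2, c) \<in> set (kids s2)" for s1 s2 b1 b2
  proof (cases "s2 = Nd a ks")
    case True
    then have "(b1, c) = (b2, c)"
      using subtrees_disjoint[OF Nd.prems(1), of "(b1,c)" "(b2,c)" c] that subtrees_self[of c] by auto
    then show ?thesis using True that by simp
  next
    case False
    then obtain k where k: "k \<in> set ks" "s2 \<in> subtrees (snd k)" using t(2) unfolding subtrees.simps by blast
    have "c \<in> subtrees s2" using kid_subtrees[OF subtrees_self that(4)] .
    then have "c \<in> subtrees (snd k)" using k subtrees_trans by blast
    then have "k = (b1, c)" using subtrees_disjoint[OF Nd.prems(1) k(1), of "(b1,c)" c] that subtrees_self[of c] by auto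
    then have "s2 \<in> subtrees c" using k by simp
    moreover obtain a' ks' where s2: "s2 = Nd a' ks'" by (cases s2)
    moreover have "distinct (labels s2)" using distinct_sub[OF that(2) Nd.prems(1)] .
    ultimately show ?thesis
    proof -
      assume *: "s2 \<in> subtrees c" "s2 = Nd a' ks'" "distinct (labels s2)"
      have "(b2, c) \<in> set ks'" using that(4) * by simp
      then show ?thesis using root_notin[of a' ks' "(b2,c)"] * by simp
    qed
  qed
  show ?case
  proof (cases "s = Nd a ks \<or> s' = Nd a ks")
    case True
    then show ?thesis
    proof
      assume "s = Nd a ks"
      from top[OF this Nd.prems(3-5)] show ?thesis .
    next
      assume "s' = Nd a ks"
      from top[OF this Nd.prems(2,5,4)] show ?thesis by blast
    qed
  next
    case False
    then obtain k k' where k: "k \<in> set ks" "s \<in> subtrees (snd k)" "k' \<in> set ks" "s' \<in> subtrees (snd k')"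
      using Nd.prems(2,3) unfolding subtrees.simps by blast
    have "c \<in> subtrees (snd k)" "c \<in> subtrees (snd k')" using kid_subtrees k Nd.prems by blast+
    then have "k = k'" using subtrees_disjoint[OF Nd.prems(1)] k by blast
    then show ?thesis using Nd.IH[OF k(1) distinct_kid[OF Nd.prems(1) k(1)]] k Nd.prems by simp
  qed
qed

lemma root_no_parent:
  assumes "distinct (labels t)" "s \<in> subtrees t" shows "(b, t) \<notin> set (kids s)"
proof
  assume c: "(b, t) \<in> set (kids s)"
  obtain a ks where s: "s = Nd a ks" by (cases s)
  have "s \<in> subtrees t" "t \<in> subtrees s" using assms kid_subtrees[OF subtrees_self c] by auto
  then show False using root_notin[of a ks "(b,t)"] s c distinct_sub[OF assms(2,1)] by simp
qed

lemma size_kid_less: "(b, c) \<in> set (kids s) \<Longrightarrow> size c < size s"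
  by (cases s) (use size_kid[of "(b,c)"] in auto)

lemma block_parent:
  "u \<in> block b t \<Longrightarrow> u \<noteq> t \<Longrightarrow> \<exists>v\<in>block b t. (\<not> b, u) \<in> set (kids v)"
proof (induction t rule: rt_induct)
  case (Nd a ks)
  then obtain k where k: "k \<in> set ks" "fst k \<noteq> b" "u \<in> block b (snd k)"
    by (auto split: if_splits)
  have "k = (\<not> b, snd k)" using k(2) by (simp add: prod_eq_iff)
  then have kk: "(\<not> b, snd k) \<in> set (kids (Nd a ks))" using k(1) by (metis rt.sel(2))
  show ?case
  proof (cases "u = snd k")
    case True
    then show ?thesis using kk block_self by blast
  next
    case False
    then obtain v where "v \<in> block b (snd k)" "(\<not> b, u) \<in> set (kids v)" using Nd.IH[OF k(1,3)] by blast
    then show ?thesis using block_step[OF block_self kk] by blast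
  qed
qed

text \<open>Climbing from \<open>u\<close> along arcs of flag \<open>\<not> b\<close> ends at the
  root or at a kid of flag \<open>b\<close>. Together with \<open>block_meet\<close> this makes the
  blocks a partition of the tree.\<close>

lemma block_cover:
  "u \<in> subtrees t \<Longrightarrow> u \<in> block b t \<or> (\<exists>s\<in>subtrees t. \<exists>c\<in>kids_of b s. u \<in> block b c)"
proof (induction t rule: rt_induct)
  case (Nd a ks)
  show ?case
  proof (cases "u = Nd a ks")
    case True
    then show ?thesis using block_self by blast
  next
    case False
    then obtain k where k: "k \<in> set ks" "u \<in> subtrees (snd k)" using Nd.prems by auto
    have sub: "subtrees (snd k) \<subseteq> subtrees (Nd a ks)" using k by auto
    from Nd.IH[OF k] consider "u \<in> block b (snd k)" | s c where "s \<in> subtrees (snd k)" "c \<in> kids_of b s" "u \<in> block b c" by blast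
    then show ?thesis
    proof cases
      case 1
      show ?thesis
      proof (cases "fst k = b")
        case True
        then have "snd k \<in> kids_of b (Nd a ks)" using k by (cases k) (auto simp: kids_of_def)
        then show ?thesis using 1 subtrees_self by blast
      next
        case False
        then have "(\<not> b, snd k) \<in> set (kids (Nd a ks))" using k by (cases k) auto
        then show ?thesis using 1 block_step[OF block_self] by blast
      qed
    next
      case 2
      then show ?thesis using sub by blast
    qed
  qed
qed

text \<open>Take a largest common subtree. If it is the top of neither block, its unique parent is
  larger and lies in both. If it is the top of just one, then inside the other block an arc of flag
  \<open>\<not> b\<close> leads to it, which \<open>top\<close> excludes.\<close>

lemma block_meet:
  assumes dt: "distinct (labels t)" and c: "c \<in> subtrees t" "c' \<in> subtrees t"
    and top: "\<And>s. s \<in> subtrees t \<Longrightarrow> (\<not> b, c) \<notin> set (kids s)" "\<And>s. s \<in> subtrees t \<Longrightarrow> (\<not> b, c') \<notin> set (kids s)"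
    and ne: "block b c \<inter> block b c' \<noteq> {}"
  shows "c = c'"
proof (rule ccontr)
  assume "c \<noteq> c'"
  let ?I = "block b c \<inter> block b c'"
  have fin: "finite ?I" using finite_subset[OF block_subtrees finite_subtrees] by blast
  have "Max (size ` ?I) \<in> size ` ?I" using fin ne by (intro Max_in) auto
  then obtain u where u: "u \<in> ?I" "size u = Max (size ` ?I)" by auto
  have umax: "size v \<le> size u" if "v \<in> ?I" for v
    unfolding u(2) using fin that by (intro Max_ge) auto
  have sub: "block b c \<subseteq> subtrees t" "block b c' \<subseteq> subtrees t"
    using block_subtrees subtrees_trans[OF c(1)] subtrees_trans[OF c(2)] by blast+
  show False
  proof (cases "u = c \<or> u = c'")
    case True
    then show ?thesis
    proof
      assume "u = c"
      then obtain v where "v \<in> block b c'" "(\<not> b, c) \<in> set (kids v)" using block_parent[of u b c'] u(1) \<open>c \<noteq> c'\<close> by auto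
      then show False using top(1) sub(2) by blast
    next
      assume "u = c'"
      then obtain v where "v \<in> block b c" "(\<not> b, c') \<in> set (kids v)" using block_parent[of u b c] u(1) \<open>c \<noteq> c'\<close> by auto
      then show False using top(2) sub(1) by blast
    qed
  next
    case False
    then obtain v v' where v: "v \<in> block b c" "(\<not> b, u) \<in> set (kids v)" "v' \<in> block b c'" "(\<not> b, u) \<in> set (kids v')"
      using block_parent[of u b c] block_parent[of u b c'] u(1) by blast
    then have "v = v'" using parent_unique[OF dt] sub by blast
    then have "v \<in> ?I" using v by blast
    then show False using umax size_kid_less[OF v(2)] by fastforce
  qed
qed

lemma block_induct:
  assumes "u \<in> block b t" "P t" "\<And>v d. v \<in> block b t \<Longrightarrow> P v \<Longrightarrow> (\<not> b, d) \<in> set (kids v) \<Longrightarrow> P d"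
  shows "P u"
  using assms
proof (induction t rule: rt_induct)
  case (Nd a ks)
  show ?case
  proof (cases "u = Nd a ks")
    case False
    then obtain k where k: "k \<in> set ks" "fst k \<noteq> b" "u \<in> block b (snd k)"
      using Nd.prems(1) by (auto split: if_splits)
    have "k = (\<not> b, snd k)" using k(2) by (simp add: prod_eq_iff)
  then have kk: "(\<not> b, snd k) \<in> set (kids (Nd a ks))" using k(1) by (metis rt.sel(2))
    have "P (snd k)" by (rule Nd.prems(3)[OF block_self Nd.prems(2) kk])
    then show ?thesis using Nd.IH[OF k(1,3)] Nd.prems(3) block_step[OF block_self kk] by blast
  qed (use Nd.prems in simp)
qed

section \<open>Embedding trees block by block\<close>

text \<open>A block is an arborescence, which embeds in a tournament with as many vertices as the block has
  vertices plus leaves, minus one. Here it gets \<open>width b s\<close> vertices for each \<open>s\<close>; only the slot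
  \<open>(s, 0)\<close> is a vertex of the tree, the other slots are padding.\<close>

definition width :: "bool \<Rightarrow> 'a rt \<Rightarrow> nat" where
  "width b s = max 1 (card (kids_of (\<not> b) s))"

lemma kids_of_disjoint:
  assumes "distinct (labels t)" "s \<in> subtrees t" "s' \<in> subtrees t" "s \<noteq> s' \<or> b \<noteq> b'"
  shows "kids_of b s \<inter> kids_of b' s' = {}"
  using parent_unique[OF assms(1-3)] assms(4) unfolding kids_of_def by blast

text \<open>Growth from a single node, with the kids of flag \<open>\<not> b\<close> as groups and
  no constraints. For \<open>k\<close> such kids the width is \<open>1 + (k - 1)\<close> with
  truncated subtraction, so the total width is exactly what growth asks for.\<close>

lemma embed_block:
  assumes P: "is_tournament P E" and dt: "distinct (labels t)"
    and big: "(\<Sum>s\<in>block b t. width b s) \<le> card P"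
  obtains h where "inj_on h (block b t)" "h ` block b t \<subseteq> P"
    "\<And>u d. u \<in> block b t \<Longrightarrow> d \<in> kids_of (\<not> b) u \<Longrightarrow> dir E (\<not> b) (h u) (h d)"
proof -
  let ?N = "block b t"
  let ?ch = "\<lambda>s. kids_of (\<not> b) s"
  have fin: "finite ?N" using finite_subset[OF block_subtrees finite_subtrees] .
  have ch_sub: "?ch s \<subseteq> ?N" if "s \<in> ?N" for s
    using block_step[OF that] block_self unfolding kids_of_def by fast
  have sub: "s \<in> subtrees t" if "s \<in> ?N" for s using that block_subtrees by blast
  have bd: "card ?N + card {t} + (\<Sum>s\<in>?N. card (?ch s) - 1) \<le> card P + 1"
  proof -
    have "(\<Sum>s\<in>?N. width b s) = (\<Sum>s\<in>?N. 1 + (card (?ch s) - 1))"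
      by (rule sum.cong) (auto simp: width_def)
    also have "\<dots> = card ?N + (\<Sum>s\<in>?N. card (?ch s) - 1)" unfolding sum.distrib by simp
    finally show ?thesis using big by simp
  qed
  show thesis
  proof (rule tournament_growth[where N = ?N and ?N0.0 = "{t}" and ch = ?ch and ?G0.0 = "\<lambda>_. True"
        and G = "\<lambda>_ _. True", OF is_tournament_dir[OF P, of "\<not> b"]])
    show "?N = {t} \<union> (\<Union>x\<in>?N. ?ch x)"
    proof
      show "?N \<subseteq> {t} \<union> (\<Union>x\<in>?N. ?ch x)" using block_parent[of _ b t] unfolding kids_of_def by blast
      show "{t} \<union> (\<Union>x\<in>?N. ?ch x) \<subseteq> ?N" using ch_sub block_self by blast
    qed
    show "?ch x \<inter> {t} = {}" if "x \<in> ?N" for x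
      using root_no_parent[OF dt sub[OF that]] unfolding kids_of_def by blast
    show "?ch x \<inter> ?ch y = {}" if "x \<in> ?N" "y \<in> ?N" "x \<noteq> y" for x y
      using kids_of_disjoint[OF dt sub sub] that by blast
    show "X = ?N" if "{t} \<subseteq> X" "X \<subseteq> ?N" "\<And>x. x \<in> X \<Longrightarrow> ?ch x \<subseteq> X" for X
    proof
      show "?N \<subseteq> X"
      proof
        fix u assume "u \<in> ?N"
        then show "u \<in> X"
          by (rule block_induct) (use that in \<open>auto simp: kids_of_def\<close>)
      qed
    qed (use that in blast)
    show "\<exists>g. bij_betw g {t} Q \<and> True" if "Q \<subseteq> P" "card Q = card {t}" for Q
      using that finite_same_card_bij[of "{t}" Q] P by (metis card.infinite card_1_singleton_iff finite.emptyI finite_insert is_singleton_altdef is_singleton_def)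
    show "\<exists>g. bij_betw g (?ch x) Q \<and> True" if "Q \<subseteq> P" "card Q = card (?ch x)" for x Q
      using that finite_same_card_bij[OF finite_kids_of, of Q] P finite_subset unfolding is_tournament_def by metis
  next
    fix f
    assume f: "inj_on f ?N" "f ` ?N \<subseteq> P"
      and d: "\<And>x c. x \<in> ?N \<Longrightarrow> c \<in> ?ch x \<Longrightarrow> dir E (\<not> b) (f x) (f c)"
    show thesis by (rule that[OF f]) (rule d)
  qed (use fin bd in auto)
qed

text \<open>Cut \<open>P\<close> into sets of the sizes of the \<open>A c\<close>. As
  \<open>H c\<close> depends only on the values on \<open>A c\<close>, the bijections can be chosen
  independently and glued. This is for groups that consist of the blocks of several kids.\<close>

lemma bij_family:
  assumes "finite C" "\<And>c. c \<in> C \<Longrightarrow> finite (A c)"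
    and "\<And>c c'. c \<in> C \<Longrightarrow> c' \<in> C \<Longrightarrow> c \<noteq> c' \<Longrightarrow> A c \<inter> A c' = {}"
    and "finite P" "card P = card (\<Union>c\<in>C. A c)"
    and "\<And>c Q. c \<in> C \<Longrightarrow> Q \<subseteq> P \<Longrightarrow> card Q = card (A c) \<Longrightarrow> \<exists>g. bij_betw g (A c) Q \<and> H c g"
    and "\<And>c g h. c \<in> C \<Longrightarrow> H c g \<Longrightarrow> (\<And>x. x \<in> A c \<Longrightarrow> h x = g x) \<Longrightarrow> H c h"
  shows "\<exists>g. bij_betw g (\<Union>c\<in>C. A c) P \<and> (\<forall>c\<in>C. H c g)"
  using assms
proof (induction C arbitrary: P rule: finite_induct)
  case empty
  then show ?case by (auto simp: bij_betw_def)
next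
  case (insert c C)
  let ?U = "\<Union>c\<in>C. A c"
  have dj: "A c \<inter> ?U = {}" using insert.prems(2) insert.hyps(2) by fastforce
  have finU: "finite ?U" using insert.hyps(1) insert.prems(1) by blast
  have fA: "finite (A c)" using insert.prems(1) by blast
  have cP: "card P = card (A c) + card ?U" using insert.prems(4) card_Un_disjoint[OF fA finU dj] by simp
  then obtain Q where Q: "Q \<subseteq> P" "card Q = card (A c)"
    using obtain_subset_with_card_n[of "card (A c)" P] by (metis le_add1)
  have "card (P - Q) = card ?U" using Q cP insert.prems(3) by (simp add: card_Diff_subset finite_subset)
  obtain g1 where g1: "bij_betw g1 (A c) Q" "H c g1" using insert.prems(5)[of c Q] Q by auto
  have "\<exists>g. bij_betw g ?U (P - Q) \<and> (\<forall>c\<in>C. H c g)"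
  proof (rule insert.IH)
    show "\<exists>g. bij_betw g (A d) R \<and> H d g" if "d \<in> C" "R \<subseteq> P - Q" "card R = card (A d)" for d R
      using insert.prems(5)[of d R] that by auto
    show "H d h" if "d \<in> C" "H d g" "\<And>x. x \<in> A d \<Longrightarrow> h x = g x" for d g h
      using insert.prems(6)[of d g h] that by auto
  qed (use insert.prems(1-3) \<open>card (P - Q) = card ?U\<close> in auto)
  then obtain g2 where g2: "bij_betw g2 ?U (P - Q)" "\<forall>c\<in>C. H c g2" by blast
  define g where "g = (\<lambda>x. if x \<in> A c then g1 x else g2 x)"
  have e1: "g x = g1 x" if "x \<in> A c" for x using that by (simp add: g_def)
  have e2: "g x = g2 x" if "x \<in> ?U" for x using that dj by (auto simp: g_def)
  have "bij_betw g (A c) Q" using g1(1) bij_betw_cong[of "A c" g g1 Q] e1 by blast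
  moreover have "bij_betw g ?U (P - Q)" using g2(1) bij_betw_cong[of ?U g g2 "P - Q"] e2 by blast
  ultimately have "bij_betw g (A c \<union> ?U) (Q \<union> (P - Q))" by (rule bij_betw_combine) blast
  then have "bij_betw g (\<Union>c\<in>insert c C. A c) P" using Q by (simp add: Un_absorb1)
  moreover have "H c g" using insert.prems(6)[OF _ g1(2), of g] e1 by blast
  moreover have "H d g" if "d \<in> C" for d
    using insert.prems(6)[of d g2 g] g2(2) e2 that by blast
  ultimately show ?case by (intro exI[of _ g]) blast
qed

section \<open>Blocks padded to their total width\<close>

definition padded_block :: "bool \<Rightarrow> 'a rt \<Rightarrow> ('a rt \<times> nat) set" where
  "padded_block b t = Sigma (block b t) (\<lambda>s. {..<width b s})"

definition padded_block_ok :: "('v \<Rightarrow> 'v \<Rightarrow> bool) \<Rightarrow> bool \<Rightarrow> 'a rt \<Rightarrow> ('a rt \<times> nat \<Rightarrow> 'v) \<Rightarrow> bool" where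
  "padded_block_ok E b t g \<longleftrightarrow> (\<forall>u\<in>block b t. \<forall>d\<in>kids_of (\<not> b) u. dir E (\<not> b) (g (u, 0)) (g (d, 0)))"

lemma finite_block: "finite (block b t)" using finite_subset[OF block_subtrees finite_subtrees] .

lemma width_pos: "0 < width b s" by (simp add: width_def)

lemma finite_padded_block: "finite (padded_block b t)" unfolding padded_block_def using finite_block by (intro finite_SigmaI) auto

lemma card_padded_block: "card (padded_block b t) = (\<Sum>s\<in>block b t. width b s)"
  unfolding padded_block_def by (subst card_SigmaI) (auto simp: finite_block)

lemma padded_block_real: "u \<in> block b t \<Longrightarrow> (u, 0) \<in> padded_block b t" using width_pos by (auto simp: padded_block_def)

lemma padded_block_ok_cong: "padded_block_ok E b t g \<Longrightarrow> (\<And>x. x \<in> padded_block b t \<Longrightarrow> h x = g x) \<Longrightarrow> padded_block_ok E b t h"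
proof -
  assume g: "padded_block_ok E b t g" and e: "\<And>x. x \<in> padded_block b t \<Longrightarrow> h x = g x"
  have "h (u, 0) = g (u, 0) \<and> h (d, 0) = g (d, 0)" if "u \<in> block b t" "d \<in> kids_of (\<not> b) u" for u d
  proof -
    have "d \<in> block b t" using that block_step[OF that(1), of d] block_self[of d b] unfolding kids_of_def by blast
    then show ?thesis using e padded_block_real that by blast
  qed
  note e' = this
  show ?thesis
    unfolding padded_block_ok_def
  proof (intro ballI)
    fix u d assume u: "u \<in> block b t" "d \<in> kids_of (\<not> b) u"
    show "dir E (\<not> b) (h (u, 0)) (h (d, 0))" using g u e'[OF u] unfolding padded_block_ok_def by fastforce
  qed
qed

text \<open>The block goes in by \<open>embed_block\<close> and the padding takes the vertices left
  over. This yields a bijection with an arbitrary set of the right size, as growth demands for a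
  group.\<close>

lemma embed_padded_block:
  assumes P: "is_tournament P E" and dt: "distinct (labels t)" and c: "card P = card (padded_block b t)"
  shows "\<exists>g. bij_betw g (padded_block b t) P \<and> padded_block_ok E b t g"
proof -
  obtain h where h: "inj_on h (block b t)" "h ` block b t \<subseteq> P"
    "\<And>u d. u \<in> block b t \<Longrightarrow> d \<in> kids_of (\<not> b) u \<Longrightarrow> dir E (\<not> b) (h u) (h d)"
    using embed_block[OF P dt, of b] c unfolding card_padded_block by auto
  let ?R = "(\<lambda>u. (u, 0::nat)) ` block b t"
  have R: "?R \<subseteq> padded_block b t" using padded_block_real by blast
  have finP: "finite P" using P by (simp add: is_tournament_def)
  have cR: "card ?R = card (h ` block b t)" using h(1) by (simp add: card_image inj_on_def)
  have "card (padded_block b t - ?R) = card (padded_block b t) - card ?R"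
    by (rule card_Diff_subset[OF _ R]) (simp add: finite_block)
  also have "\<dots> = card P - card (h ` block b t)" using c cR by simp
  also have "\<dots> = card (P - h ` block b t)"
    by (rule card_Diff_subset[OF _ h(2), symmetric]) (simp add: finite_block)
  finally have "card (padded_block b t - ?R) = card (P - h ` block b t)" .
  then obtain g2 where g2: "bij_betw g2 (padded_block b t - ?R) (P - h ` block b t)"
    using finite_same_card_bij[of "padded_block b t - ?R" "P - h ` block b t"] finP finite_padded_block by auto
  define g where "g = (\<lambda>x. if x \<in> ?R then h (fst x) else g2 x)"
  have "bij_betw (h \<circ> fst) ?R (h ` block b t)"
    using h(1) by (auto simp: bij_betw_def inj_on_def image_comp)
  then have "bij_betw g ?R (h ` block b t)"
    by (subst bij_betw_cong[of _ _ "h \<circ> fst"]) (auto simp: g_def)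
  moreover have "bij_betw g (padded_block b t - ?R) (P - h ` block b t)"
    using g2 by (subst bij_betw_cong[of _ _ g2]) (auto simp: g_def)
  ultimately have "bij_betw g (?R \<union> (padded_block b t - ?R)) (h ` block b t \<union> (P - h ` block b t))"
    by (rule bij_betw_combine) blast
  then have "bij_betw g (padded_block b t) P" using R h(2) by (simp add: Un_absorb1)
  moreover have "padded_block_ok E b t g"
    unfolding padded_block_ok_def
  proof (intro ballI)
    fix u d assume u: "u \<in> block b t" "d \<in> kids_of (\<not> b) u"
    then have "d \<in> block b t" using block_step[OF u(1), of d] block_self[of d b] unfolding kids_of_def by blast
    then have "g (u, 0) = h u" "g (d, 0) = h d" using u(1) by (auto simp: g_def)
    then show "dir E (\<not> b) (g (u, 0)) (g (d, 0))" using h(3)[OF u] by simp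
  qed
  ultimately show ?thesis by blast
qed

definition slots :: "bool \<Rightarrow> 'a rt \<Rightarrow> ('a rt \<times> nat) set" where
  "slots b t = Sigma (subtrees t) (\<lambda>s. {..<width b s})"

text \<open>A padding slot counts as a leaf in the growth; only the slot \<open>(s, 0)\<close>
  causes blocks to be placed.\<close>

definition children :: "bool \<Rightarrow> 'a rt \<times> nat \<Rightarrow> ('a rt \<times> nat) set" where
  "children b x = (if snd x = 0 then \<Union>c\<in>kids_of b (fst x). padded_block b c else {})"

lemma padded_block_meet:
  assumes dt: "distinct (labels t)" and s: "s \<in> subtrees t" "s' \<in> subtrees t" "c \<in> kids_of b s" "c' \<in> kids_of b s'"
    and ne: "padded_block b c \<inter> padded_block b c' \<noteq> {}"
  shows "c = c' \<and> s = s'"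
proof -
  have c: "(b, c) \<in> set (kids s)" "(b, c') \<in> set (kids s')" using s by (auto simp: kids_of_def)
  have "c = c'"
  proof (rule block_meet[OF dt])
    show "c \<in> subtrees t" "c' \<in> subtrees t" using s kids_of_subtrees by blast+
    show "(\<not> b, c) \<notin> set (kids u)" if "u \<in> subtrees t" for u
      using parent_unique[OF dt s(1) that c(1)] by auto
    show "(\<not> b, c') \<notin> set (kids u)" if "u \<in> subtrees t" for u
      using parent_unique[OF dt s(2) that c(2)] by auto
    show "block b c \<inter> block b c' \<noteq> {}" using ne unfolding padded_block_def by blast
  qed
  then show ?thesis using parent_unique[OF dt s(1,2) c(1)] c(2) by blast
qed

lemma padded_block_root_meet:
  assumes dt: "distinct (labels t)" and s: "s \<in> subtrees t" "c \<in> kids_of b s"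
  shows "padded_block b c \<inter> padded_block b t = {}"
proof (rule ccontr)
  assume ne: "padded_block b c \<inter> padded_block b t \<noteq> {}"
  have c: "(b, c) \<in> set (kids s)" using s by (auto simp: kids_of_def)
  have "c = t"
  proof (rule block_meet[OF dt])
    show "c \<in> subtrees t" "t \<in> subtrees t" using s kids_of_subtrees subtrees_self by blast+
    show "(\<not> b, c) \<notin> set (kids u)" if "u \<in> subtrees t" for u
      using parent_unique[OF dt s(1) that c] by auto
    show "(\<not> b, t) \<notin> set (kids u)" if "u \<in> subtrees t" for u
      using root_no_parent[OF dt that] .
    show "block b c \<inter> block b t \<noteq> {}" using ne unfolding padded_block_def by blast
  qed
  then show False using root_no_parent[OF dt s(1)] c by blast
qed

lemma card_kids_of:
  assumes "distinct (labels (Nd a ks))"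
  shows "card (kids_of b (Nd a ks)) = length (filter (\<lambda>k. fst k = b) ks)"
proof -
  have "kids_of b (Nd a ks) = set (map snd (filter (\<lambda>k. fst k = b) ks))" by (force simp: kids_of_def)
  moreover have "distinct (map snd (filter (\<lambda>k. fst k = b) ks))"
    using distinct_kids(1)[of ks] assms by (simp add: distinct_map_filter)
  ultimately show ?thesis using distinct_card by (metis length_map)
qed

lemma card_children:
  assumes "distinct (labels (Nd a ks))"
  shows "card (children b (Nd a ks, 0)) = (\<Sum>k\<leftarrow>ks. if fst k = b then card (padded_block b (snd k)) else 0)"
proof -
  have e: "children b (Nd a ks, 0) = (\<Union>k\<in>set ks. if fst k = b then padded_block b (snd k) else {})"
    by (force simp: children_def kids_of_def)
  have "sum (\<lambda>_. 1::nat) (\<Union>k\<in>set ks. if fst k = b then padded_block b (snd k) else {}) =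
     (\<Sum>k\<leftarrow>ks. sum (\<lambda>_. 1) (if fst k = b then padded_block b (snd k) else {}))"
  proof (rule sum_list_UN[OF distinct_ks[OF assms]])
    show "finite (if fst k = b then padded_block b (snd k) else {})" for k by (simp add: finite_padded_block)
    show "(if fst k = b then padded_block b (snd k) else {}) \<inter> (if fst k' = b then padded_block b (snd k') else {}) = {}"
      if "k \<in> set ks" "k' \<in> set ks" "k \<noteq> k'" for k k'
    proof -
      have "subtrees (snd k) \<inter> subtrees (snd k') = {}" using subtrees_disjoint[OF assms that(1,2)] that(3) by blast
      then show ?thesis using block_subtrees[of b "snd k"] block_subtrees[of b "snd k'"] unfolding padded_block_def by auto
    qed
  qed
  moreover have "(\<Sum>k\<leftarrow>ks. sum (\<lambda>_. 1::nat) (if fst k = b then padded_block b (snd k) else {})) =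
    (\<Sum>k\<leftarrow>ks. if fst k = b then card (padded_block b (snd k)) else 0)"
    by (rule arg_cong[where f = sum_list], rule map_cong) auto
  ultimately show ?thesis unfolding e card_eq_sum by simp
qed

lemma sum_list_cancel:
  fixes p q r :: "'c \<Rightarrow> nat"
  assumes "\<And>k. k \<in> set ks \<Longrightarrow> p k + q k = r k"
  shows "(\<Sum>k\<leftarrow>ks. p k) + (\<Sum>k\<leftarrow>ks. q k) = (\<Sum>k\<leftarrow>ks. r k)"
  using assms by (induction ks) fastforce+

text \<open>The left side is the demand of growth on the slots when it starts with the block of the
  root. The block of a kid is counted once at its parent, within the parent's block or within its
  group, according to the flag. The width of the root is counted twice, and
  \<open>2 * max 1 k = 2 + 2 * (k - 1)\<close>; one is saved if the group of the root is
  nonempty.\<close>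

lemma cost_eq:
  "distinct (labels t) \<Longrightarrow> sum (width b) (subtrees t) + sum (width b) (block b t) +
     (\<Sum>s\<in>subtrees t. card (children b (s, 0)) - 1) = cost b t"
proof (induction t rule: rt_induct)
  case (Nd a ks)
  let ?t = "Nd a ks"
  let ?e = "\<lambda>s. card (children b (s, 0)) - 1"
  let ?w = "\<lambda>k. sum (width b) (subtrees (snd k))"
  let ?g = "\<lambda>k. card (padded_block b (snd k))"
  let ?f = "\<lambda>k. sum ?e (subtrees (snd k))"
  have IH: "?w k + ?g k + ?f k = cost b (snd k)" if "k \<in> set ks" for k
    using Nd.IH[OF that distinct_kid[OF Nd.prems that]] unfolding card_padded_block .
  have a1: "(\<Sum>k\<leftarrow>ks. ?w k) + (\<Sum>k\<leftarrow>ks. ?g k) = (\<Sum>k\<leftarrow>ks. ?w k + ?g k)"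
    by (rule sum_list_cancel) simp
  have a2: "(\<Sum>k\<leftarrow>ks. ?w k + ?g k) + (\<Sum>k\<leftarrow>ks. ?f k) = (\<Sum>k\<leftarrow>ks. cost b (snd k))"
    by (rule sum_list_cancel) (rule IH)
  have a3: "(\<Sum>k\<leftarrow>ks. if fst k = b then 0 else ?g k) + (\<Sum>k\<leftarrow>ks. if fst k = b then ?g k else 0) = (\<Sum>k\<leftarrow>ks. ?g k)"
    by (rule sum_list_cancel) simp
  have w: "sum (width b) (subtrees ?t) = width b ?t + (\<Sum>k\<leftarrow>ks. ?w k)" by (rule sum_subtrees[OF Nd.prems])
  have f: "sum ?e (subtrees ?t) = ?e ?t + (\<Sum>k\<leftarrow>ks. ?f k)" by (rule sum_subtrees[OF Nd.prems])
  have g: "sum (width b) (block b ?t) = width b ?t + (\<Sum>k\<leftarrow>ks. if fst k = b then 0 else ?g k)"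
    using sum_block[OF Nd.prems, of "width b" b] unfolding card_padded_block .
  have G: "card (children b (?t, 0)) = (\<Sum>k\<leftarrow>ks. if fst k = b then ?g k else 0)" by (rule card_children[OF Nd.prems])
  have wt: "width b ?t = max 1 (length (filter (\<lambda>k. fst k \<noteq> b) ks))"
  proof -
    have "(\<lambda>k. fst k = (\<not> b)) = (\<lambda>k::bool \<times> 'a rt. fst k \<noteq> b)" by auto
    then show ?thesis unfolding width_def card_kids_of[OF Nd.prems] by metis
  qed
  show ?case
  proof (cases "\<exists>c. (b, c) \<in> set ks")
    case True
    then obtain c where c: "(b, c) \<in> set ks" by blast
    \<comment> \<open>A nonempty group makes the truncated subtraction in \<open>?e ?t\<close>
      remove exactly one; this is the case distinction in \<open>cost\<close>.\<close>
    have "1 \<le> card (padded_block b c)"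
      using padded_block_real[OF block_self, of c b] finite_padded_block by (metis One_nat_def Suc_leI card_gt_0_iff empty_iff)
    also have "\<dots> \<le> (\<Sum>k\<leftarrow>ks. if fst k = b then ?g k else 0)"
      using c member_le_sum_list[of "card (padded_block b c)" "map (\<lambda>k. if fst k = b then ?g k else 0) ks"] by force
    finally have "1 \<le> (\<Sum>k\<leftarrow>ks. if fst k = b then ?g k else 0)" .
    then show ?thesis unfolding w f g using G wt a1 a2 a3 True by simp
  next
    case False
    define Z where "Z = (\<Sum>k\<leftarrow>ks. if fst k = b then ?g k else 0)"
    have "fst k \<noteq> b" if "k \<in> set ks" for k
    proof
      assume "fst k = b"
      then have "k = (b, snd k)" by (simp add: prod_eq_iff)
      then show False using False that by metis
    qed
    then have "Z = 0" unfolding Z_def by (auto simp: sum_list_eq_0_iff)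
    then show ?thesis unfolding w f g using G[folded Z_def] wt a1 a2 a3[folded Z_def] False by simp
  qed
qed

text \<open>Growth in direction \<open>b\<close> on the slots, where the group of a vertex is made
  of the blocks of its kids of flag \<open>b\<close>. The arcs of flag \<open>b\<close> are realized
  by growth; every other arc lies inside a block and is realized by the constraint on its
  group.\<close>

lemma embed_tree:
  fixes t :: "'a rt" and V :: "'v set"
  assumes V: "is_tournament V E" and dt: "distinct (labels t)" and big: "cost b t \<le> card V + 1"
  obtains f where "inj_on f (set (labels t))" "f ` set (labels t) \<subseteq> V" "embeds E f t"
proof -
  let ?N = "slots b t"
  let ?G = "\<lambda>x g. snd x = 0 \<longrightarrow> (\<forall>c\<in>kids_of b (fst x). padded_block_ok E b c g)"
  have finN: "finite ?N" unfolding slots_def using finite_subtrees by (intro finite_SigmaI) auto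
  have padded_block_sub: "padded_block b c \<subseteq> ?N" if "c \<in> subtrees t" for c
    using block_subtrees[of b c] subtrees_trans[OF that] unfolding padded_block_def slots_def by blast
  have ch_sub: "children b x \<subseteq> ?N" if "x \<in> ?N" for x
  proof -
    have "fst x \<in> subtrees t" using that by (auto simp: slots_def)
    then show ?thesis using padded_block_sub kids_of_subtrees[of "fst x" t] unfolding children_def by auto
  qed
  have real: "(s, 0) \<in> ?N" if "s \<in> subtrees t" for s using that width_pos by (auto simp: slots_def)
  have cover: "x \<in> padded_block b t \<or> (\<exists>s\<in>subtrees t. x \<in> children b (s, 0))" if x: "x \<in> ?N" for x
  proof -
    have "fst x \<in> subtrees t" using x by (auto simp: slots_def)
    from block_cover[OF this, of b] show ?thesis using x by (force simp: slots_def padded_block_def children_def)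
  qed
  have fins: "finite P" if "P \<subseteq> V" for P using V that finite_subset unfolding is_tournament_def by blast
  have one: "\<exists>g. bij_betw g (padded_block b c) P \<and> padded_block_ok E b c g"
    if "c \<in> subtrees t" "P \<subseteq> V" "card P = card (padded_block b c)" for c P
    by (rule embed_padded_block[OF is_tournament_subset[OF V that(2)] distinct_sub[OF that(1) dt] that(3)])
  obtain F where F: "inj_on F ?N" "F ` ?N \<subseteq> V" "padded_block_ok E b t F" "\<And>x. x \<in> ?N \<Longrightarrow> ?G x F"
    "\<And>x c. x \<in> ?N \<Longrightarrow> c \<in> children b x \<Longrightarrow> dir E b (F x) (F c)"
  proof (rule tournament_growth[where N = ?N and ?N0.0 = "padded_block b t" and ch = "children b" and ?G0.0 = "padded_block_ok E b t"
        and G = ?G, OF is_tournament_dir[OF V, of b] finN])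
    note obt = that
    show "padded_block b t \<noteq> {}" using padded_block_real[OF block_self] by blast
    show "?N = padded_block b t \<union> (\<Union>x\<in>?N. children b x)"
    proof
      show "?N \<subseteq> padded_block b t \<union> (\<Union>x\<in>?N. children b x)" using cover real by blast
      show "padded_block b t \<union> (\<Union>x\<in>?N. children b x) \<subseteq> ?N" using ch_sub padded_block_sub[OF subtrees_self] by blast
    qed
    show "children b x \<inter> padded_block b t = {}" if "x \<in> ?N" for x
    proof -
      have "fst x \<in> subtrees t" using that by (auto simp: slots_def)
      then show ?thesis using padded_block_root_meet[OF dt] unfolding children_def by auto
    qed
    show "children b x \<inter> children b y = {}" if xy: "x \<in> ?N" "y \<in> ?N" "x \<noteq> y" for x y
    proof (rule ccontr)
      assume "children b x \<inter> children b y \<noteq> {}"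
      then obtain z c c' where z: "snd x = 0" "snd y = 0" "c \<in> kids_of b (fst x)" "c' \<in> kids_of b (fst y)"
        "z \<in> padded_block b c" "z \<in> padded_block b c'"
        unfolding children_def by (auto split: if_splits)
      have "fst x \<in> subtrees t" "fst y \<in> subtrees t" using xy by (auto simp: slots_def)
      then have "fst x = fst y" using padded_block_meet[OF dt _ _ z(3,4)] z(5,6) by blast
      then show False using xy(3) z(1,2) by (metis prod_eqI)
    qed
    show "X = ?N" if X: "padded_block b t \<subseteq> X" "X \<subseteq> ?N" "\<And>x. x \<in> X \<Longrightarrow> children b x \<subseteq> X" for X
    proof
      \<comment> \<open>From the root downwards: the block of a kid of flag \<open>b\<close> belongs
        to the group of the parent, the block of any other kid to the block of the parent.\<close>
      have "Sigma (subtrees u) (\<lambda>s. {..<width b s}) \<subseteq> X" if "padded_block b u \<subseteq> X" for u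
        using that
      proof (induction u rule: rt_induct)
        case (Nd a ks)
        let ?u = "Nd a ks"
        have "Sigma (subtrees (snd k)) (\<lambda>s. {..<width b s}) \<subseteq> X" if k: "k \<in> set ks" for k
        proof (rule Nd.IH[OF k])
          show "padded_block b (snd k) \<subseteq> X"
          proof (cases "fst k = b")
            case True
            then have "k = (b, snd k)" by (simp add: prod_eq_iff)
            then have "snd k \<in> kids_of b ?u" using k unfolding kids_of_def by (metis (mono_tags) mem_Collect_eq rt.sel(2))
            then have "padded_block b (snd k) \<subseteq> children b (?u, 0)" by (auto simp: children_def)
            then show ?thesis using X(3) padded_block_real[OF block_self, of ?u b] Nd.prems by blast
          next
            case False
            then have "k = (\<not> b, snd k)" by (simp add: prod_eq_iff)
            then have "(\<not> b, snd k) \<in> set (kids ?u)" using k by (metis rt.sel(2))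
            then have "block b (snd k) \<subseteq> block b ?u" using block_step[OF block_self] by blast
            then show ?thesis using Nd.prems unfolding padded_block_def by blast
          qed
        qed
        moreover have "(?u, i) \<in> X" if "i < width b ?u" for i
          using Nd.prems that block_self[of ?u b] unfolding padded_block_def by blast
        ultimately show ?case by auto
      qed
      from this[OF X(1)] show "?N \<subseteq> X" unfolding slots_def .
    qed (rule X(2))
    have "card ?N = sum (width b) (subtrees t)"
      unfolding slots_def by (subst card_SigmaI) (auto simp: finite_subtrees)
    moreover have "(\<Sum>x\<in>?N. card (children b x) - 1) = (\<Sum>s\<in>subtrees t. card (children b (s, 0)) - 1)"
    proof -
      have "(\<Sum>x\<in>?N. card (children b x) - 1) = (\<Sum>x\<in>(\<lambda>s. (s, 0)) ` subtrees t. card (children b x) - 1)"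
        by (rule sum.mono_neutral_right[OF finN]) (use real in \<open>auto simp: children_def slots_def image_iff\<close>)
      also have "\<dots> = (\<Sum>s\<in>subtrees t. card (children b (s, 0)) - 1)"
        by (subst sum.reindex) (auto simp: inj_on_def)
      finally show ?thesis .
    qed
    ultimately show "card ?N + card (padded_block b t) + (\<Sum>x\<in>?N. card (children b x) - 1) \<le> card V + 1"
      using cost_eq[OF dt, of b] big unfolding card_padded_block by simp
    show "\<exists>g. bij_betw g (padded_block b t) P \<and> padded_block_ok E b t g" if "P \<subseteq> V" "card P = card (padded_block b t)" for P
      by (rule one[OF subtrees_self that])
    show "\<exists>g. bij_betw g (children b x) P \<and> ?G x g" if x: "x \<in> ?N" "P \<subseteq> V" "card P = card (children b x)" for x P
    proof (cases "snd x = 0")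
      case True
      have s: "fst x \<in> subtrees t" using x by (auto simp: slots_def)
      have e: "children b x = (\<Union>c\<in>kids_of b (fst x). padded_block b c)" using True by (simp add: children_def)
      have "\<exists>g. bij_betw g (\<Union>c\<in>kids_of b (fst x). padded_block b c) P \<and> (\<forall>c\<in>kids_of b (fst x). padded_block_ok E b c g)"
      proof (rule bij_family[OF finite_kids_of finite_padded_block])
        show "padded_block b c \<inter> padded_block b c' = {}" if "c \<in> kids_of b (fst x)" "c' \<in> kids_of b (fst x)" "c \<noteq> c'" for c c'
          using padded_block_meet[OF dt s s that(1,2)] that(3) by blast
        show "card P = card (\<Union>c\<in>kids_of b (fst x). padded_block b c)" using x(3) e by simp
        show "\<exists>g. bij_betw g (padded_block b c) Q \<and> padded_block_ok E b c g"
          if "c \<in> kids_of b (fst x)" "Q \<subseteq> P" "card Q = card (padded_block b c)" for c Q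
          using one[OF kids_of_subtrees[OF s that(1)] _ that(3)] that(2) x(2) by blast
        show "padded_block_ok E b c h" if "padded_block_ok E b c g" "\<And>x. x \<in> padded_block b c \<Longrightarrow> h x = g x" for c g h
          by (rule padded_block_ok_cong[OF that])
      qed (use fins x in blast)
      then show ?thesis unfolding e by blast
    next
      case False
      then show ?thesis using x(3) fins[OF x(2)] by (auto simp: children_def bij_betw_def)
    qed
    show "padded_block_ok E b t h" if "padded_block_ok E b t g" "\<And>c. c \<in> padded_block b t \<Longrightarrow> h c = g c" for g h
      by (rule padded_block_ok_cong[OF that])
    show "?G x h" if "?G x g" "\<And>c. c \<in> children b x \<Longrightarrow> h c = g c" for x g h
    proof (intro impI ballI)
      fix c assume "snd x = 0" "c \<in> kids_of b (fst x)"
      then show "padded_block_ok E b c h"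
        using that by (intro padded_block_ok_cong[of E b c g h]) (auto simp: children_def)
    qed
    show thesis if f: "inj_on f ?N" "f ` ?N \<subseteq> V" "padded_block_ok E b t f" "\<And>x. x \<in> ?N \<Longrightarrow> ?G x f"
      "\<And>x c. x \<in> ?N \<Longrightarrow> c \<in> children b x \<Longrightarrow> dir E b (f x) (f c)" for f
      by (rule obt[OF f])
  qed
  have arcs: "dir E d (F (s, 0)) (F (c, 0))" if s: "s \<in> subtrees t" and c: "(d, c) \<in> set (kids s)" for s c d
  proof (cases "d = b")
    case True
    then have "c \<in> kids_of b s" using c by (simp add: kids_of_def)
    then have m: "(c, 0) \<in> children b (s, 0)" using padded_block_real[OF block_self, of c b] by (auto simp: children_def)
    show ?thesis using F(5)[OF real[OF s] m] unfolding True .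
  next
    case False
    then have d: "d = (\<not> b)" by simp
    then have cs: "c \<in> kids_of (\<not> b) s" using c by (simp add: kids_of_def)
    from block_cover[OF s, of b] show ?thesis
    proof
      assume "s \<in> block b t"
      then show ?thesis using F(3) cs d unfolding padded_block_ok_def by blast
    next
      assume "\<exists>s'\<in>subtrees t. \<exists>c\<in>kids_of b s'. s \<in> block b c"
      then obtain s' c' where "s' \<in> subtrees t" "c' \<in> kids_of b s'" "s \<in> block b c'" by blast
      then show ?thesis using F(4)[OF real, of s'] cs d unfolding padded_block_ok_def by fastforce
    qed
  qed
  define f where "f = (\<lambda>x. F (inv_into (subtrees t) lab x, 0))"
  have inj: "inj_on lab (subtrees t)" by (rule inj_lab[OF dt])
  have fl: "f (lab s) = F (s, 0)" if "s \<in> subtrees t" for s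
    unfolding f_def using inv_into_f_f[OF inj that] by simp
  show thesis
  proof
    show "inj_on f (set (labels t))"
      unfolding labels_subtrees
    proof (rule inj_onI, elim imageE)
      fix x y s s' assume h: "f x = f y" "x = lab s" "s \<in> subtrees t" "y = lab s'" "s' \<in> subtrees t"
      then have "F (s, 0) = F (s', 0)" using fl by simp
      then have "(s, 0::nat) = (s', 0)" using inj_onD[OF F(1)] real h by blast
      then show "x = y" using h by simp
    qed
    show "f ` set (labels t) \<subseteq> V" unfolding labels_subtrees using fl F(2) real by auto
    show "embeds E f t"
      unfolding embeds_def
    proof (intro ballI, clarify)
      fix s d c assume s: "s \<in> subtrees t" and c: "(d, c) \<in> set (kids s)"
      show "dir E d (f (lab s)) (f (lab c))" using arcs[OF s c] fl[OF s] fl[OF kid_subtrees[OF s c]] by simp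
    qed
  qed
qed

section \<open>Attaching small branches\<close>

lemma embeds_Nd:
  "embeds E f (Nd a ks) \<longleftrightarrow> (\<forall>k\<in>set ks. dir E (fst k) (f a) (f (lab (snd k))) \<and> embeds E f (snd k))"
  unfolding embeds_def by (auto split: prod.splits)

lemma embeds_cong:
  assumes "embeds E f t" "\<And>x. x \<in> set (labels t) \<Longrightarrow> g x = f x"
  shows "embeds E g t"
  unfolding embeds_def
proof (intro ballI, clarify)
  fix s b c assume s: "s \<in> subtrees t" "(b, c) \<in> set (kids s)"
  have "c \<in> subtrees t" by (rule kid_subtrees[OF s])
  then have "g (lab s) = f (lab s)" "g (lab c) = f (lab c)" using assms(2) s(1) unfolding labels_subtrees by auto
  moreover have "dir E b (f (lab s)) (f (lab c))" using assms(1) s unfolding embeds_def by fast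
  ultimately show "dir E b (g (lab s)) (g (lab c))" by simp
qed

text \<open>The core keeps a kid if its flag is \<open>b\<close> or its branch satisfies \<open>P\<close>. The branches cut off are
  listed by \<open>pending\<close> together with the label of the vertex where they are to be attached; all of them
  have flag \<open>\<not> b\<close>.\<close>

fun core :: "bool \<Rightarrow> ('a rt \<Rightarrow> bool) \<Rightarrow> 'a rt \<Rightarrow> 'a rt" where
  "core b P (Nd a ks) =
     Nd a (map (\<lambda>k. (fst k, core b P (snd k))) (filter (\<lambda>k. fst k = b \<or> P (snd k)) ks))"

fun pending :: "bool \<Rightarrow> ('a rt \<Rightarrow> bool) \<Rightarrow> 'a rt \<Rightarrow> ('a \<times> 'a rt) list" where
  "pending b P (Nd a ks) =
     map (\<lambda>k. (a, snd k)) (filter (\<lambda>k. \<not> (fst k = b \<or> P (snd k))) ks) @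
     concat (map (\<lambda>k. pending b P (snd k)) (filter (\<lambda>k. fst k = b \<or> P (snd k)) ks))"

lemma lab_core: "lab (core b P t) = lab t" by (cases t) simp

text \<open>Each kid is kept or cut off as a whole. As an equation of multisets this yields
  distinctness, the union of the label sets and the lengths at once.\<close>

lemma mset_core:
  "mset (labels (core b P t)) + mset (concat (map (\<lambda>x. labels (snd x)) (pending b P t))) = mset (labels t)"
proof (induction t rule: rt_induct)
  case (Nd a ks)
  have "mset (concat (map (\<lambda>k. labels (core b P (snd k))) (filter (\<lambda>k. fst k = b \<or> P (snd k)) ks))) +
     (mset (concat (map (\<lambda>k. labels (snd k)) (filter (\<lambda>k. \<not> (fst k = b \<or> P (snd k))) ks))) +
      mset (concat (map (\<lambda>x. labels (snd x)) (concat (map (\<lambda>k. pending b P (snd k)) (filter (\<lambda>k. fst k = b \<or> P (snd k)) ks)))))) =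
     mset (concat (map (\<lambda>k. labels (snd k)) ks))"
    using Nd
  proof (induction ks)
    case (Cons k ks)
    have "mset (labels (core b P (snd k))) + mset (concat (map (\<lambda>x. labels (snd x)) (pending b P (snd k)))) = mset (labels (snd k))"
      using Cons.prems by simp
    from this[symmetric] Cons show ?case by (simp add: add_ac)
  qed simp
  then show ?case by (simp add: o_def)
qed

lemma pending_host: "(x, c) \<in> set (pending b P t) \<Longrightarrow> x \<in> set (labels (core b P t))"
proof (induction t rule: rt_induct)
  case (Nd a ks)
  then show ?case by fastforce
qed

lemma pending_subtrees: "(x, c) \<in> set (pending b P t) \<Longrightarrow> c \<in> subtrees t \<and> \<not> P c"
proof (induction t rule: rt_induct)
  case (Nd a ks)
  then show ?case using subtrees_self by fastforce
qed

lemma embeds_core: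
  assumes "embeds E f (core b P t)"
    and "\<And>x c. (x, c) \<in> set (pending b P t) \<Longrightarrow> dir E (\<not> b) (f x) (f (lab c)) \<and> embeds E f c"
  shows "embeds E f t"
  using assms
proof (induction t rule: rt_induct)
  case (Nd a ks)
  have "dir E (fst k) (f a) (f (lab (snd k))) \<and> embeds E f (snd k)" if k: "k \<in> set ks" for k
  proof (cases "fst k = b \<or> P (snd k)")
    case True
    then have kk: "(fst k, core b P (snd k)) \<in> set (kids (core b P (Nd a ks)))" using k by auto
    then have "dir E (fst k) (f a) (f (lab (core b P (snd k)))) \<and> embeds E f (core b P (snd k))"
      using Nd.prems(1) unfolding core.simps embeds_Nd by fastforce
    moreover have "embeds E f (snd k)" if "embeds E f (core b P (snd k))"
    proof (rule Nd.IH[OF k that])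
      fix x c assume "(x, c) \<in> set (pending b P (snd k))"
      moreover have "k \<in> set (filter (\<lambda>k. fst k = b \<or> P (snd k)) ks)" using k True by simp
      ultimately have "(x, c) \<in> set (pending b P (Nd a ks))"
        unfolding pending.simps set_append set_concat set_map by blast
      then show "dir E (\<not> b) (f x) (f (lab c)) \<and> embeds E f c" by (rule Nd.prems(2))
    qed
    ultimately show ?thesis unfolding lab_core by blast
  next
    case False
    then have "(a, snd k) \<in> set (pending b P (Nd a ks))" using k by force
    moreover have "fst k = (\<not> b)" using False by blast
    ultimately show ?thesis using Nd.prems(2) by metis
  qed
  then show ?case unfolding embeds_Nd by blast
qed

section \<open>Monochromatic components and small branches\<close>

abbreviation mono_part :: "bool \<Rightarrow> 'a rt \<Rightarrow> 'a rt" where "mono_part b \<equiv> core b (\<lambda>_. False)"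

definition mono_size :: "bool \<Rightarrow> 'a rt \<Rightarrow> nat" where "mono_size b t = length (labels (mono_part b t))"

text \<open>The threshold comes from the count in \<open>complete_branches\<close>. Suppose a branch
  of \<open>s\<close> vertices with component sizes \<open>p\<close> and \<open>q\<close> fits on
  neither side. Then \<open>s + \<sigma> + 4\<close> is at most the sum of the two costs, which is
  at most \<open>2p + 2q\<close>, and less if \<open>p\<close> or \<open>q\<close> is at least 2. As
  \<open>p + q \<le> s + 1\<close>, this forces \<open>p + q \<ge> \<sigma> + 4\<close>. The
  condition is hereditary because what is cut off from a small branch is attached in the same
  way.\<close>

fun small :: "nat \<Rightarrow> 'a rt \<Rightarrow> bool" where
  "small \<sigma> (Nd a ks) \<longleftrightarrow> mono_size True (Nd a ks) + mono_size False (Nd a ks) \<le> \<sigma> + 3 \<and> (\<forall>k\<in>set ks. small \<sigma> (snd k))"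

lemma small_subtrees: "small \<sigma> t \<Longrightarrow> s \<in> subtrees t \<Longrightarrow> small \<sigma> s"
proof (induction t rule: rt_induct)
  case (Nd a ks)
  then show ?case by auto
qed

lemma small_mono_size: "small \<sigma> t \<Longrightarrow> mono_size True t + mono_size False t \<le> \<sigma> + 3" by (cases t) simp

lemma mono_size_le: "mono_size b t \<le> length (labels t)"
proof -
  have "size (mset (labels (mono_part b t))) \<le> size (mset (labels t))"
    using mset_core[of b "\<lambda>_. False" t] by (metis mset_subset_eq_add_left size_mset_mono)
  then show ?thesis by (simp add: mono_size_def)
qed

lemma mono_size_Nd: "mono_size b (Nd a ks) = 1 + (\<Sum>k\<leftarrow>ks. if fst k = b then mono_size b (snd k) else 0)"
  by (induction ks) (auto simp: mono_size_def)

lemma length_labels_Nd: "length (labels (Nd a ks)) = 1 + (\<Sum>k\<leftarrow>ks. length (labels (snd k)))"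
  by (simp add: length_concat o_def)

lemma mono_size_pos: "1 \<le> mono_size b t" by (cases t) (simp add: mono_size_Nd)

text \<open>The two components share only the root.\<close>

lemma mono_size_sum: "mono_size True t + mono_size False t \<le> length (labels t) + 1"
proof (cases t)
  case (Nd a ks)
  have "(\<Sum>k\<leftarrow>ks. if fst k = True then mono_size True (snd k) else 0) + (\<Sum>k\<leftarrow>ks. if fst k = False then mono_size False (snd k) else 0)
     \<le> (\<Sum>k\<leftarrow>ks. length (labels (snd k)))"
    by (induction ks) (use mono_size_le in \<open>auto intro: add_mono simp: add.left_commute add.assoc\<close>)
  then show ?thesis unfolding Nd mono_size_Nd length_labels_Nd by simp
qed

text \<open>With no kids of the other flag the cost is the number of vertices plus the number of
  leaves, and the root is not a leaf as soon as there is a second vertex.\<close>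

lemma cost_comp: "cost b (mono_part b t) \<le> 2 * mono_size b t - (if mono_size b t \<ge> 2 then 1 else 0)"
proof (induction t rule: rt_induct)
  case (Nd a ks)
  let ?fs = "filter (\<lambda>k. fst k = b) ks"
  have e: "(\<Sum>k\<leftarrow>ks. if fst k = b then mono_size b (snd k) else 0) = (\<Sum>k\<leftarrow>?fs. mono_size b (snd k))"
    by (induction ks) auto
  have "(\<Sum>k\<leftarrow>?fs. cost b (mono_part b (snd k))) \<le> (\<Sum>k\<leftarrow>?fs. 2 * mono_size b (snd k))"
    by (rule sum_list_mono) (use Nd in fastforce)
  also have "\<dots> = 2 * (\<Sum>k\<leftarrow>?fs. mono_size b (snd k))" by (rule sum_list_const_mult)
  finally have s: "(\<Sum>k\<leftarrow>?fs. cost b (mono_part b (snd k))) \<le> 2 * (\<Sum>k\<leftarrow>?fs. mono_size b (snd k))" .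
  have nof: "filter (\<lambda>k. fst k \<noteq> b) (map (\<lambda>k. (fst k, mono_part b (snd k))) ?fs) = []"
    by (auto simp: filter_empty_conv)
  have c: "cost b (mono_part b (Nd a ks)) = 1 + (if \<exists>c. (b, c) \<in> set (map (\<lambda>k. (fst k, mono_part b (snd k))) ?fs) then 0 else 1) +
      (\<Sum>k\<leftarrow>?fs. cost b (mono_part b (snd k)))"
    using nof by (simp add: o_def)
  show ?case
  proof (cases "?fs = []")
    case True
    then show ?thesis unfolding c mono_size_Nd e by simp
  next
    case False
    then obtain k where k: "k \<in> set ?fs" by (cases ?fs) auto
    then have "(b, mono_part b (snd k)) \<in> set (map (\<lambda>k. (fst k, mono_part b (snd k))) ?fs)" by force
    then have c': "cost b (mono_part b (Nd a ks)) = 1 + (\<Sum>k\<leftarrow>?fs. cost b (mono_part b (snd k)))" unfolding c by auto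
    have "mono_size b (snd k) \<le> (\<Sum>k\<leftarrow>?fs. mono_size b (snd k))" using k by (intro member_le_sum_list) auto
    then have "1 \<le> (\<Sum>k\<leftarrow>?fs. mono_size b (snd k))" using mono_size_pos[of b "snd k"] by linarith
    then show ?thesis unfolding c' mono_size_Nd e using s by simp
  qed
qed

definition deg :: "'v set \<Rightarrow> ('v \<Rightarrow> 'v \<Rightarrow> bool) \<Rightarrow> bool \<Rightarrow> 'v \<Rightarrow> nat" where
  "deg V E b v = card {u\<in>V. dir E b v u}"

lemma deg_sum:
  assumes V: "is_tournament V E" and v: "v \<in> V"
  shows "deg V E b v + deg V E (\<not> b) v + 1 = card V"
proof -
  let ?A = "\<lambda>b. {u\<in>V. dir E b v u}"
  have fin: "finite V" and as: "\<And>u. u \<in> V \<Longrightarrow> E v u \<Longrightarrow> \<not> E u v" using V v by (auto simp: is_tournament_def)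
  have "V = insert v (?A b \<union> ?A (\<not> b))" using V v unfolding is_tournament_def by (cases b) auto
  moreover have "v \<notin> ?A b \<union> ?A (\<not> b)" by (cases b) (use V v in \<open>auto simp: is_tournament_def\<close>)
  moreover have disj: "?A b \<inter> ?A (\<not> b) = {}" by (cases b) (use as in auto)
  ultimately have "card V = Suc (card (?A b \<union> ?A (\<not> b)))" using fin by (metis (no_types, lifting) card_insert_disjoint finite_insert)
  also have "card (?A b \<union> ?A (\<not> b)) = card (?A b) + card (?A (\<not> b))"
    by (rule card_Un_disjoint) (use fin disj in auto)
  finally show ?thesis unfolding deg_def by simp
qed

text \<open>A vertex with few out-neighbours has many in-neighbours. So each component of a pending branch
  goes either to vertices rich in one direction or to vertices rich in the other, and whichever
  side is taken, the arcs that remain to be placed leave the rich way.\<close>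

lemma complete_branches:
  fixes f :: "'a \<Rightarrow> 'v"
  assumes V: "is_tournament V E" and big: "2 * n + 2 * \<sigma> \<le> card V + 2"
    and "distinct (concat (map (\<lambda>p. labels (snd (snd p))) ps))"
    and "X \<inter> set (concat (map (\<lambda>p. labels (snd (snd p))) ps)) = {}"
    and "finite X" "inj_on f X" "f ` X \<subseteq> V"
    and "card X + length (concat (map (\<lambda>p. labels (snd (snd p))) ps)) \<le> n"
    and "\<And>x b c. (x, b, c) \<in> set ps \<Longrightarrow> x \<in> X \<and> small \<sigma> c \<and> n + \<sigma> \<le> deg V E b (f x) + 1"
  shows "\<exists>g. (\<forall>x\<in>X. g x = f x) \<and> inj_on g (X \<union> set (concat (map (\<lambda>p. labels (snd (snd p))) ps))) \<and>
    g ` (X \<union> set (concat (map (\<lambda>p. labels (snd (snd p))) ps))) \<subseteq> V \<and>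
    (\<forall>(x, b, c)\<in>set ps. dir E b (g x) (g (lab c)) \<and> embeds E g c)"
  using assms(3-)
proof (induction "length (concat (map (\<lambda>p. labels (snd (snd p))) ps))" arbitrary: ps X f rule: less_induct)
  case less
  let ?L = "\<lambda>ps :: ('a \<times> bool \<times> 'a rt) list. concat (map (\<lambda>p. labels (snd (snd p))) ps)"
  show ?case
  proof (cases ps)
    case Nil
    then show ?thesis using less.prems by (intro exI[of _ f]) auto
  next
    case (Cons p qs)
    obtain x b c where p: "p = (x, b, c)" by (cases p) auto
    have ps: "ps = (x, b, c) # qs" using Cons p by simp
    have xX: "x \<in> X" and sm: "small \<sigma> c" and dx: "n + \<sigma> \<le> deg V E b (f x) + 1"
      using less.prems(7)[of x b c] ps by auto
    have finV: "finite V" using V by (simp add: is_tournament_def)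
    have dc: "distinct (labels c)" using less.prems(1) ps by simp
    define Q where "Q = {u\<in>V. dir E b (f x) u} - f ` X"
    have fxV: "f x \<in> V" using xX less.prems(5) by blast
    \<comment> \<open>The vertex \<open>f x\<close> is not its own neighbour, so at most
      \<open>card X - 1\<close> of its neighbours are occupied. This leaves room for
      \<open>c\<close> and \<open>\<sigma>\<close> more vertices.\<close>
    have "card Q + card X \<ge> deg V E b (f x) + 1"
    proof -
      have nf: "f x \<notin> {u\<in>V. dir E b (f x) u}" using V fxV unfolding is_tournament_def by auto
      have "Q = {u\<in>V. dir E b (f x) u} - f ` (X - {x})" using nf unfolding Q_def by blast
      then have "card Q \<ge> card {u\<in>V. dir E b (f x) u} - card (f ` (X - {x}))"
        using diff_card_le_card_Diff[of "f ` (X - {x})"] less.prems(3) by auto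
      moreover have "card (f ` (X - {x})) \<le> card (X - {x})" using less.prems(3) by (intro card_image_le) auto
      moreover have "card (X - {x}) = card X - 1" "card X \<ge> 1"
        using less.prems(3) xX by (auto simp: card_gt_0_iff Suc_le_eq)
      ultimately show ?thesis unfolding deg_def by linarith
    qed
    moreover have "card X + length (labels c) \<le> n" using less.prems(6) ps by simp
    ultimately have cQ: "length (labels c) + \<sigma> \<le> card Q" using dx by linarith
    \<comment> \<open>\<open>Qe e\<close> collects the vertices rich in direction
      \<open>\<not> e\<close>. They are hosts for the component of direction \<open>e\<close>, whose
      further branches hang by arcs of flag \<open>\<not> e\<close>.\<close>
    define Qe where "Qe = (\<lambda>e. {u\<in>Q. n + \<sigma> \<le> deg V E (\<not> e) u + 1})"
    have finQ: "finite Q" using finV by (simp add: Q_def)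
    have "Q \<subseteq> Qe True \<union> Qe False"
    proof
      fix u assume u: "u \<in> Q"
      then have "deg V E True u + deg V E False u + 1 = card V" using deg_sum[OF V, of u True] by (auto simp: Q_def)
      then have "n + \<sigma> \<le> deg V E True u + 1 \<or> n + \<sigma> \<le> deg V E False u + 1" using big by linarith
      then show "u \<in> Qe True \<union> Qe False" using u by (auto simp: Qe_def)
    qed
    then have "card Q \<le> card (Qe True \<union> Qe False)" by (rule card_mono[rotated]) (use finQ in \<open>auto simp: Qe_def\<close>)
    also have "\<dots> \<le> card (Qe True) + card (Qe False)" by (rule card_Un_le)
    finally have cQe: "card Q \<le> card (Qe True) + card (Qe False)" .
    have "\<exists>e. cost e (mono_part e c) \<le> card (Qe e) + 1"
    proof (rule ccontr)
      assume "\<not> ?thesis"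
      then have "card (Qe True) + 2 \<le> cost True (mono_part True c)" "card (Qe False) + 2 \<le> cost False (mono_part False c)"
        by (auto simp: not_le dest: spec[of _ True] spec[of _ False])
      moreover note cost_comp[of True c] cost_comp[of False c] mono_size_pos[of True c] mono_size_pos[of False c]
        mono_size_sum[of c] small_mono_size[OF sm]
      moreover have "length (labels c) \<ge> 1" by (cases c) simp
      ultimately show False using cQ cQe by (auto split: if_splits)
    qed
    then obtain e where e: "cost e (mono_part e c) \<le> card (Qe e) + 1" by blast
    let ?C = "mono_part e c"
    let ?R = "pending e (\<lambda>_. False) c"
    let ?M = "concat (map (\<lambda>x. labels (snd x)) ?R)"
    have ms: "mset (labels ?C @ ?M) = mset (labels c)" using mset_core[of e "\<lambda>_. False" c] by simp
    then have dCM: "distinct (labels ?C @ ?M)" using dc mset_eq_imp_distinct_iff by blast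
    have sCM: "set (labels ?C) \<union> set ?M = set (labels c)" using mset_eq_setD[OF ms] by simp
    have lCM: "length (labels ?C) + length ?M = length (labels c)" using mset_eq_length[OF ms] by simp
    have QeV: "Qe e \<subseteq> V" by (auto simp: Qe_def Q_def)
    obtain h where h: "inj_on h (set (labels ?C))" "h ` set (labels ?C) \<subseteq> Qe e" "embeds E h ?C"
      using embed_tree[OF is_tournament_subset[OF V QeV] _ e] dCM by auto
    define f' where "f' = (\<lambda>y. if y \<in> set (labels ?C) then h y else f y)"
    define X' where "X' = X \<union> set (labels ?C)"
    \<comment> \<open>The branches cut off from \<open>c\<close> join the list, with hosts rich in
      the direction they need. The total size drops since the component just placed is
      nonempty.\<close>
    define ps' where "ps' = map (\<lambda>r. (fst r, \<not> e, snd r)) ?R @ qs"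
    have Lps: "?L ps = labels c @ ?L qs" by (simp add: ps)
    have Lps': "?L ps' = ?M @ ?L qs" by (simp add: ps'_def o_def)
    have Xc: "X \<inter> set (labels c) = {}" "X \<inter> set (?L qs) = {}" using less.prems(2) unfolding Lps by auto
    have XC: "X \<inter> set (labels ?C) = {}" using Xc sCM by blast
    have cq: "set (labels c) \<inter> set (?L qs) = {}" "distinct (?L qs)" using less.prems(1) unfolding Lps by auto
    have old: "f' y = f y" if "y \<in> X" for y using that XC by (auto simp: f'_def)
    have new: "f' y = h y" if "y \<in> set (labels ?C)" for y using that by (simp add: f'_def)
    have mono_size: "X \<union> set (?L ps) = X' \<union> set (?L ps')" unfolding X'_def Lps Lps' using sCM by auto
    have "\<exists>g. (\<forall>x\<in>X'. g x = f' x) \<and> inj_on g (X' \<union> set (?L ps')) \<and> g ` (X' \<union> set (?L ps')) \<subseteq> V \<and>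
      (\<forall>(x, b, c)\<in>set ps'. dir E b (g x) (g (lab c)) \<and> embeds E g c)"
    proof (rule less.hyps)
      have "1 \<le> length (labels ?C)" by (cases ?C) simp
      then show "length (?L ps') < length (?L ps)" unfolding Lps Lps' using lCM by simp
      show "distinct (?L ps')" unfolding Lps' using dCM cq sCM by auto
      show "X' \<inter> set (?L ps') = {}" unfolding Lps' X'_def using Xc cq sCM dCM by auto
      show "finite X'" using less.prems(3) by (simp add: X'_def)
      have "inj_on f' X" using less.prems(4) old by (auto simp: inj_on_def)
      moreover have "inj_on f' (set (labels ?C))" using h(1) new by (auto simp: inj_on_def)
      moreover have "f' ` X \<inter> f' ` set (labels ?C) = {}"
      proof -
        have "f' ` X = f ` X" using old by auto
        moreover have "f' ` set (labels ?C) = h ` set (labels ?C)" using new by auto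
        moreover have "Qe e \<inter> f ` X = {}" by (auto simp: Qe_def Q_def)
        ultimately show ?thesis using h(2) by blast
      qed
      ultimately show "inj_on f' X'" unfolding X'_def by (subst inj_on_Un) blast
      show "f' ` X' \<subseteq> V"
      proof -
        have "f' ` X = f ` X" using old by auto
        moreover have "f' ` set (labels ?C) = h ` set (labels ?C)" using new by auto
        ultimately show ?thesis unfolding X'_def image_Un
          by (intro Un_least less.prems(5) subset_trans[OF h(2) QeV] | simp)+
      qed
      have "card X' \<le> card X + length (labels ?C)"
        unfolding X'_def using card_Un_le[of X "set (labels ?C)"] card_length[of "labels ?C"] by linarith
      then show "card X' + length (?L ps') \<le> n" using less.prems(6) lCM unfolding Lps Lps' by simp
      show "x' \<in> X' \<and> small \<sigma> c' \<and> n + \<sigma> \<le> deg V E b' (f' x') + 1" if "(x', b', c') \<in> set ps'" for x' b' c'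
      proof (cases "(x', b', c') \<in> set qs")
        case True
        then have "(x', b', c') \<in> set ps" using ps by simp
        then have "x' \<in> X \<and> small \<sigma> c' \<and> n + \<sigma> \<le> deg V E b' (f x') + 1" by (rule less.prems(7))
        then show ?thesis using old unfolding X'_def by auto
      next
        case False
        then have r: "(x', c') \<in> set ?R" "b' = (\<not> e)" using that by (auto simp: ps'_def)
        have x': "x' \<in> set (labels ?C)" by (rule pending_host[OF r(1)])
        have "small \<sigma> c'" using small_subtrees[OF sm] pending_subtrees[OF r(1)] by blast
        moreover have "h x' \<in> Qe e" using h(2) x' by blast
        ultimately show ?thesis using x' new r(2) by (auto simp: X'_def Qe_def)
      qed
    qed
    then obtain g where g: "\<forall>x\<in>X'. g x = f' x" "inj_on g (X' \<union> set (?L ps'))"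
      "g ` (X' \<union> set (?L ps')) \<subseteq> V" "\<forall>(x, b, c)\<in>set ps'. dir E b (g x) (g (lab c)) \<and> embeds E g c"
      by (elim exE conjE) (rule that)
    have g4: "dir E b (g x) (g (lab c)) \<and> embeds E g c" if "(x, b, c) \<in> set ps'" for x b c
      using bspec[OF g(4) that] by simp
    have gC: "g y = h y" if "y \<in> set (labels ?C)" for y using g(1) new that by (simp add: X'_def)
    have "embeds E g c"
    proof (rule embeds_core)
      show "embeds E g ?C" by (rule embeds_cong[OF h(3) gC])
      show "dir E (\<not> e) (g y) (g (lab d)) \<and> embeds E g d" if "(y, d) \<in> set ?R" for y d
        by (rule g4) (use that in \<open>force simp: ps'_def\<close>)
    qed
    moreover have "dir E b (g x) (g (lab c))"
    proof -
      have lc: "lab c \<in> set (labels ?C)" using lab_in_labels[of ?C] unfolding lab_core .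
      then have "h (lab c) \<in> Q" using h(2) by (auto simp: Qe_def)
      then show ?thesis using gC[OF lc] g(1) old[OF xX] xX by (simp add: Q_def X'_def)
    qed
    moreover have "\<forall>x\<in>X. g x = f x" using g(1) old by (simp add: X'_def)
    moreover have "\<forall>(x, b, c)\<in>set qs. dir E b (g x) (g (lab c)) \<and> embeds E g c" using g(4) unfolding ps'_def by simp
    ultimately show ?thesis unfolding mono_size using g(2,3) ps by (intro exI[of _ g]) auto
  qed
qed

section \<open>Cost of the two cores\<close>

lemma core_cong: "(\<And>s. s \<in> subtrees t \<Longrightarrow> P s = Q s) \<Longrightarrow> core b P t = core b Q t"
proof (induction t rule: rt_induct)
  case (Nd a ks)
  have s: "subtrees (snd k) \<subseteq> subtrees (Nd a ks)" if "k \<in> set ks" for k using that by auto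
  have "P (snd k) = Q (snd k)" if "k \<in> set ks" for k using Nd.prems s[OF that] subtrees_self by blast
  then have f: "filter (\<lambda>k. fst k = b \<or> P (snd k)) ks = filter (\<lambda>k. fst k = b \<or> Q (snd k)) ks"
    by (intro filter_cong) auto
  have "core b P (snd k) = core b Q (snd k)" if "k \<in> set ks" for k
    by (rule Nd.IH[OF that]) (use Nd.prems s[OF that] in blast)
  then show ?case unfolding core.simps f by simp
qed

abbreviation big :: "nat \<Rightarrow> 'a rt \<Rightarrow> bool" where "big \<sigma> t \<equiv> \<not> small \<sigma> t"

text \<open>Smallness passes to all subbranches, so no kid of flag \<open>\<not> b\<close>
  survives.\<close>

lemma core_small: "small \<sigma> t \<Longrightarrow> core b (big \<sigma>) t = mono_part b t"
  by (rule core_cong) (use small_subtrees in blast)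

text \<open>A parent of a big branch is big, so the big branches together with the root form a
  rooted tree. \<open>big_count\<close> is its number of vertices and \<open>big_leaves\<close> its
  number of leaves; the root is counted even if it is small.\<close>

fun big_count :: "nat \<Rightarrow> 'a rt \<Rightarrow> nat" where
  "big_count \<sigma> (Nd a ks) = 1 + (\<Sum>k\<leftarrow>filter (\<lambda>k. big \<sigma> (snd k)) ks. big_count \<sigma> (snd k))"

fun big_leaves :: "nat \<Rightarrow> 'a rt \<Rightarrow> nat" where
  "big_leaves \<sigma> (Nd a ks) = max 1 (\<Sum>k\<leftarrow>filter (\<lambda>k. big \<sigma> (snd k)) ks. big_leaves \<sigma> (snd k))"

lemma big_leaves_pos: "1 \<le> big_leaves \<sigma> t" by (cases t) simp

lemma length_filter_le_sum:
  fixes F :: "'b \<Rightarrow> nat"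
  assumes "\<And>x. x \<in> set xs \<Longrightarrow> 1 \<le> F x"
  shows "length xs \<le> sum_list (map F xs)"
proof -
  have "sum_list (map (\<lambda>_. 1) xs) \<le> sum_list (map F xs)" by (rule sum_list_mono) (rule assms)
  then show ?thesis by (simp add: sum_list_triv)
qed

text \<open>A leaf of the tree of big branches violates the threshold at its own root. So it has at
  least \<open>\<sigma> + 3\<close> vertices, all but one of them outside that tree, and distinct
  leaves are disjoint branches.\<close>

lemma big_count_big_leaves_le_length: "big \<sigma> t \<Longrightarrow> big_count \<sigma> t + big_leaves \<sigma> t * (\<sigma> + 2) \<le> length (labels t)"
proof (induction t rule: rt_induct)
  case (Nd a ks)
  let ?f = "filter (\<lambda>k. big \<sigma> (snd k)) ks"
  show ?case
  proof (cases "?f = []")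
    case True
    then have "\<forall>k\<in>set ks. small \<sigma> (snd k)" by (simp add: filter_empty_conv)
    then have "\<sigma> + 4 \<le> mono_size True (Nd a ks) + mono_size False (Nd a ks)" using Nd.prems by auto
    then have "\<sigma> + 3 \<le> length (labels (Nd a ks))" using mono_size_sum[of "Nd a ks"] by linarith
    then show ?thesis unfolding big_count.simps big_leaves.simps True by simp
  next
    case False
    have "1 \<le> length ?f" using False by (cases ?f) auto
    also have "\<dots> \<le> (\<Sum>k\<leftarrow>?f. big_leaves \<sigma> (snd k))" by (rule length_filter_le_sum) (rule big_leaves_pos)
    finally have l: "big_leaves \<sigma> (Nd a ks) = (\<Sum>k\<leftarrow>?f. big_leaves \<sigma> (snd k))" by simp
    have "(\<Sum>k\<leftarrow>?f. big_count \<sigma> (snd k)) + (\<Sum>k\<leftarrow>?f. big_leaves \<sigma> (snd k)) * (\<sigma> + 2) =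
        (\<Sum>k\<leftarrow>?f. big_count \<sigma> (snd k) + big_leaves \<sigma> (snd k) * (\<sigma> + 2))"
      by (simp add: sum_list_addf sum_list_mult_const)
    also have "\<dots> \<le> (\<Sum>k\<leftarrow>?f. length (labels (snd k)))"
      by (rule sum_list_mono) (use Nd.IH in simp)
    also have "\<dots> \<le> (\<Sum>k\<leftarrow>ks. length (labels (snd k)))" by (induction ks) auto
    finally show ?thesis unfolding l length_labels_Nd by simp
  qed
qed

text \<open>Kids of flag \<open>b\<close> are never cut off, so the test for a skipped position can
  look at all of \<open>ks\<close>, whereas only kept kids of the other flag enter the
  block.\<close>

lemma cost_core:
  "cost b (core b P (Nd a ks)) = 1 + (if b \<in> fst ` set ks then 0 else 1) +
     2 * (length (filter (\<lambda>k. fst k \<noteq> b \<and> P (snd k)) ks) - 1) +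
     (\<Sum>k\<leftarrow>ks. if fst k = b \<or> P (snd k) then cost b (core b P (snd k)) else 0)"
proof -
  let ?f = "filter (\<lambda>k. fst k = b \<or> P (snd k)) ks"
  have "(\<exists>c. (b, c) \<in> set (map (\<lambda>k. (fst k, core b P (snd k))) ?f)) \<longleftrightarrow> b \<in> fst ` set ks"
    by force
  moreover have "length (filter (\<lambda>k. fst k \<noteq> b) (map (\<lambda>k. (fst k, core b P (snd k))) ?f)) =
      length (filter (\<lambda>k. fst k \<noteq> b \<and> P (snd k)) ks)"
    by (induction ks) auto
  moreover have "(\<Sum>k\<leftarrow>map (\<lambda>k. (fst k, core b P (snd k))) ?f. cost b (snd k)) =
      (\<Sum>k\<leftarrow>ks. if fst k = b \<or> P (snd k) then cost b (core b P (snd k)) else 0)"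
    by (induction ks) auto
  ultimately show ?thesis unfolding core.simps cost.simps by presburger
qed

lemma cost_small: "small \<sigma> c \<Longrightarrow> cost b (core b (big \<sigma>) c) \<le> 2 * length (labels c)"
  unfolding core_small using cost_comp[of b c] mono_size_le[of b c] by linarith

lemma big_kids: "big \<sigma> (Nd a ks) \<Longrightarrow> ks \<noteq> []"
  by (auto simp: mono_size_Nd)

lemma length_filter_nonzero: "length (filter P xs) \<noteq> 0 \<Longrightarrow> \<exists>x\<in>set xs. P x"
  by (auto simp: filter_empty_conv)

text \<open>\<open>T\<close> and \<open>F\<close> count the big kids of either flag,
  \<open>iT\<close> and \<open>iF\<close> mark a flag that no kid has. The 2 saved at each big kid
  pays for the positions lost in the two blocks. With big kids present this is tight if they all
  have the same flag and no kid has the other.\<close>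

lemma cost_sum_arith:
  fixes ST SF f T F len K L iT iF :: nat
  assumes "ST + SF + 2 * f \<le> 2 * len + K + 2 * L" "f = T + F" "iT + iF \<le> 1"
    and "T \<noteq> 0 \<Longrightarrow> iT = 0" "F \<noteq> 0 \<Longrightarrow> iF = 0" "f \<le> L" "f = 0 \<Longrightarrow> L = 0"
  shows "(1 + iT + 2 * (F - 1) + ST) + (1 + iF + 2 * (T - 1) + SF) + 2 \<le> 2 * (1 + len) + (1 + K) + 2 * max 1 L"
  using assms by (cases T; cases F) auto

text \<open>A big kid stays in both cores, and induction bounds the sum of its costs. A small kid
  stays only in the core of its own flag, at a cost of at most twice its size. A single vertex has
  \<open>2 + 2 + 2 > 2 + 1 + 2\<close>, hence the assumption on \<open>ks\<close>; big branches
  satisfy it by \<open>big_kids\<close>.\<close>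

lemma cost_sum:
  "ks \<noteq> [] \<Longrightarrow> cost True (core True (big \<sigma>) (Nd a ks)) + cost False (core False (big \<sigma>) (Nd a ks)) + 2 \<le>
     2 * length (labels (Nd a ks)) + big_count \<sigma> (Nd a ks) + 2 * big_leaves \<sigma> (Nd a ks)"
proof (induction "Nd a ks" arbitrary: a ks rule: measure_induct_rule[where f = size])
  case (less a ks)
  let ?P = "big \<sigma>"
  let ?f = "filter (\<lambda>k. ?P (snd k)) ks"
  let ?S = "\<lambda>b. \<Sum>k\<leftarrow>ks. if fst k = b \<or> ?P (snd k) then cost b (core b ?P (snd k)) else 0"
  let ?T = "length (filter (\<lambda>k. fst k \<noteq> False \<and> ?P (snd k)) ks)"
  let ?F = "length (filter (\<lambda>k. fst k \<noteq> True \<and> ?P (snd k)) ks)"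
  have kid: "cost True (core True ?P (snd k)) + cost False (core False ?P (snd k)) + 2 \<le>
      2 * length (labels (snd k)) + big_count \<sigma> (snd k) + 2 * big_leaves \<sigma> (snd k)" if k: "k \<in> set ks" "?P (snd k)" for k
  proof -
    obtain a' ks' where c: "snd k = Nd a' ks'" by (cases "snd k")
    have "size (snd k) < size (Nd a ks)" using size_kid[OF k(1)] by simp
    then show ?thesis using less.hyps[of a' ks'] big_kids[of \<sigma> a' ks'] k(2) c by simp
  qed
  have "?S True + ?S False + 2 * length ?f \<le> 2 * (\<Sum>k\<leftarrow>ks. length (labels (snd k))) +
      (\<Sum>k\<leftarrow>?f. big_count \<sigma> (snd k)) + 2 * (\<Sum>k\<leftarrow>?f. big_leaves \<sigma> (snd k))"
    using kid
  proof (induction ks)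
    case (Cons k ks)
    have IH: "(\<Sum>k\<leftarrow>ks. if fst k = True \<or> ?P (snd k) then cost True (core True ?P (snd k)) else 0) +
      (\<Sum>k\<leftarrow>ks. if fst k = False \<or> ?P (snd k) then cost False (core False ?P (snd k)) else 0) +
      2 * length (filter (\<lambda>k. ?P (snd k)) ks) \<le> 2 * (\<Sum>k\<leftarrow>ks. length (labels (snd k))) +
      (\<Sum>k\<leftarrow>filter (\<lambda>k. ?P (snd k)) ks. big_count \<sigma> (snd k)) + 2 * (\<Sum>k\<leftarrow>filter (\<lambda>k. ?P (snd k)) ks. big_leaves \<sigma> (snd k))"
      by (rule Cons.IH) (use Cons.prems in simp)
    show ?case
    proof (cases "?P (snd k)")
      case True
      then show ?thesis using IH Cons.prems[of k] by simp
    next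
      case False
      then show ?thesis using IH cost_small[of \<sigma> "snd k" True] cost_small[of \<sigma> "snd k" False]
        by (cases "fst k") simp_all
    qed
  qed simp
  then show ?case unfolding cost_core length_labels_Nd big_count.simps big_leaves.simps
  proof (rule cost_sum_arith)
    show "length ?f = ?T + ?F" by (induction ks) auto
    obtain k where "k \<in> set ks" using less.prems by (cases ks) auto
    then have "fst k \<in> fst ` set ks" by (rule imageI)
    then show "(if True \<in> fst ` set ks then 0 else 1) + (if False \<in> fst ` set ks then 0 else 1) \<le> (1::nat)"
      by (cases "fst k") auto
    show "(if True \<in> fst ` set ks then 0 else 1) = (0::nat)" if nz: "?T \<noteq> 0"
    proof -
      obtain k where k: "k \<in> set ks" "fst k" using length_filter_nonzero[OF nz] by blast
      from k(1) have "fst k \<in> fst ` set ks" by (rule imageI)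
      then show ?thesis using k(2) by simp
    qed
    show "(if False \<in> fst ` set ks then 0 else 1) = (0::nat)" if nz: "?F \<noteq> 0"
    proof -
      obtain k where k: "k \<in> set ks" "\<not> fst k" using length_filter_nonzero[OF nz] by blast
      from k(1) have "fst k \<in> fst ` set ks" by (rule imageI)
      then show ?thesis using k(2) by simp
    qed
    show "length ?f \<le> (\<Sum>k\<leftarrow>?f. big_leaves \<sigma> (snd k))" by (rule length_filter_le_sum) (rule big_leaves_pos)
    show "(\<Sum>k\<leftarrow>?f. big_leaves \<sigma> (snd k)) = 0" if "length ?f = 0" using that by simp
  qed
qed

text \<open>The sets \<open>W True\<close> and \<open>W False\<close> cover \<open>V\<close>, so if
  neither core fitted, the two costs would sum to at least \<open>card V + 4\<close>. A core placed
  in \<open>W e\<close> has hosts of the kind that \<open>complete_branches\<close>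
  requires.\<close>

lemma embed_by_core:
  assumes V: "is_tournament V E" and dt: "distinct (labels t)"
    and n: "2 * length (labels t) + 2 * \<sigma> \<le> card V + 2"
    and c: "cost True (core True (big \<sigma>) t) + cost False (core False (big \<sigma>) t) \<le> card V + 3"
  shows "\<exists>g. inj_on g (set (labels t)) \<and> g ` set (labels t) \<subseteq> V \<and> embeds E g t"
proof -
  let ?n = "length (labels t)"
  define W where "W = (\<lambda>e. {v\<in>V. ?n + \<sigma> \<le> deg V E (\<not> e) v + 1})"
  have finV: "finite V" using V by (simp add: is_tournament_def)
  have "V \<subseteq> W True \<union> W False"
  proof
    fix v assume v: "v \<in> V"
    then have "deg V E True v + deg V E False v + 1 = card V" using deg_sum[OF V, of v True] by simp
    then have "?n + \<sigma> \<le> deg V E True v + 1 \<or> ?n + \<sigma> \<le> deg V E False v + 1" using n by linarith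
    then show "v \<in> W True \<union> W False" using v by (auto simp: W_def)
  qed
  then have "card V \<le> card (W True \<union> W False)" by (rule card_mono[rotated]) (use finV in \<open>auto simp: W_def\<close>)
  also have "\<dots> \<le> card (W True) + card (W False)" by (rule card_Un_le)
  finally have "cost True (core True (big \<sigma>) t) \<le> card (W True) + 1 \<or> cost False (core False (big \<sigma>) t) \<le> card (W False) + 1"
    using c by linarith
  then obtain e where e: "cost e (core e (big \<sigma>) t) \<le> card (W e) + 1" by blast
  let ?C = "core e (big \<sigma>) t"
  let ?R = "pending e (big \<sigma>) t"
  let ?M = "concat (map (\<lambda>x. labels (snd x)) ?R)"
  have ms: "mset (labels ?C @ ?M) = mset (labels t)" using mset_core[of e "big \<sigma>" t] by simp
  then have dCM: "distinct (labels ?C @ ?M)" using dt mset_eq_imp_distinct_iff by blast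
  have sCM: "set (labels ?C) \<union> set ?M = set (labels t)" using mset_eq_setD[OF ms] by simp
  have lCM: "length (labels ?C) + length ?M = ?n" using mset_eq_length[OF ms] by simp
  have WV: "W e \<subseteq> V" by (auto simp: W_def)
  obtain h where h: "inj_on h (set (labels ?C))" "h ` set (labels ?C) \<subseteq> W e" "embeds E h ?C"
    using embed_tree[OF is_tournament_subset[OF V WV] _ e] dCM by auto
  define ps where "ps = map (\<lambda>r. (fst r, \<not> e, snd r)) ?R"
  have Lps: "concat (map (\<lambda>p. labels (snd (snd p))) ps) = ?M" by (simp add: ps_def o_def)
  have "\<exists>g. (\<forall>x\<in>set (labels ?C). g x = h x) \<and> inj_on g (set (labels ?C) \<union> set ?M) \<and>
      g ` (set (labels ?C) \<union> set ?M) \<subseteq> V \<and> (\<forall>(x, b, c)\<in>set ps. dir E b (g x) (g (lab c)) \<and> embeds E g c)"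
    unfolding Lps[symmetric]
  proof (rule complete_branches[OF V n])
    show "card (set (labels ?C)) + length (concat (map (\<lambda>p. labels (snd (snd p))) ps)) \<le> ?n"
      unfolding Lps using lCM card_length[of "labels ?C"] by linarith
    show "x \<in> set (labels ?C) \<and> small \<sigma> c \<and> ?n + \<sigma> \<le> deg V E b (h x) + 1" if "(x, b, c) \<in> set ps" for x b c
    proof -
      have r: "(x, c) \<in> set ?R" "b = (\<not> e)" using that by (auto simp: ps_def)
      have x: "x \<in> set (labels ?C)" by (rule pending_host[OF r(1)])
      have "small \<sigma> c" using pending_subtrees[OF r(1)] by blast
      moreover have "h x \<in> W e" using h(2) x by blast
      ultimately show ?thesis using x r(2) by (simp add: W_def)
    qed
  qed (use h dCM WV Lps in auto)
  then obtain g where g: "\<forall>x\<in>set (labels ?C). g x = h x" "inj_on g (set (labels t))" "g ` set (labels t) \<subseteq> V"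
      "\<forall>(x, b, c)\<in>set ps. dir E b (g x) (g (lab c)) \<and> embeds E g c"
    unfolding sCM by (elim exE conjE) (rule that)
  have g4: "dir E b (g x) (g (lab c)) \<and> embeds E g c" if "(x, b, c) \<in> set ps" for x b c
    using bspec[OF g(4) that] by simp
  have "embeds E g t"
  proof (rule embeds_core)
    show "embeds E g ?C" by (rule embeds_cong[OF h(3)]) (use g(1) in simp)
    show "dir E (\<not> e) (g y) (g (lab d)) \<and> embeds E g d" if "(y, d) \<in> set ?R" for y d
      by (rule g4) (use that in \<open>force simp: ps_def\<close>)
  qed
  then show ?thesis using g(2,3) by blast
qed

section \<open>Choice of the root\<close>

fun arcs_of :: "'a rt \<Rightarrow> ('a \<times> 'a) set" where
  "arcs_of (Nd a ks) = (\<Union>k\<in>set ks. insert (if fst k then (a, lab (snd k)) else (lab (snd k), a)) (arcs_of (snd k)))"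

text \<open>An embedding depends only on the set of arcs. This lets the root move, and links rooted
  trees to the given digraph.\<close>

lemma embeds_arcs: "embeds E f t \<longleftrightarrow> (\<forall>(u, v)\<in>arcs_of t. E (f u) (f v))"
proof (induction t rule: rt_induct)
  case (Nd a ks)
  have "embeds E f (Nd a ks) \<longleftrightarrow> (\<forall>k\<in>set ks. dir E (fst k) (f a) (f (lab (snd k))) \<and> (\<forall>(u, v)\<in>arcs_of (snd k). E (f u) (f v)))"
    unfolding embeds_Nd using Nd by blast
  also have "\<dots> \<longleftrightarrow> (\<forall>k\<in>set ks. (case if fst k then (a, lab (snd k)) else (lab (snd k), a) of (u, v) \<Rightarrow> E (f u) (f v)) \<and>
      (\<forall>(u, v)\<in>arcs_of (snd k). E (f u) (f v)))"
    by (intro ball_cong refl arg_cong2[where f = "(\<and>)"]) simp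
  also have "\<dots> \<longleftrightarrow> (\<forall>(u, v)\<in>arcs_of (Nd a ks). E (f u) (f v))"
    by (simp only: arcs_of.simps ball_UN ball_simps)
  finally show ?case .
qed

lemma split_at_unique_big: "length (filter (\<lambda>k. big \<sigma> (snd k)) ks) = 1 \<Longrightarrow>
  \<exists>us b c vs. ks = us @ (b, c) # vs \<and> big \<sigma> c \<and> (\<forall>k\<in>set (us @ vs). small \<sigma> (snd k))"
proof -
  assume "length (filter (\<lambda>k. big \<sigma> (snd k)) ks) = 1"
  then obtain k where "filter (\<lambda>k. big \<sigma> (snd k)) ks = [k]" by (auto simp: length_Suc_conv)
  then obtain us vs where k: "ks = us @ k # vs" "\<forall>u\<in>set us. \<not> big \<sigma> (snd u)" "big \<sigma> (snd k)"
      "[] = filter (\<lambda>k. big \<sigma> (snd k)) vs"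
    using filter_eq_ConsD by fast
  obtain b c where bc: "k = (b, c)" by (cases k)
  have "\<forall>k\<in>set (us @ vs). small \<sigma> (snd k)" using k(2) k(4)[symmetric] by (auto simp: filter_empty_conv)
  moreover have "ks = us @ (b, c) # vs" "big \<sigma> c" using k bc by simp_all
  ultimately show ?thesis by blast
qed

lemma reroot_arith: "\<sigma> + 3 \<le> x \<Longrightarrow> kc + 1 * (\<sigma> + 2) \<le> y \<Longrightarrow> n = x + y \<Longrightarrow> k = 1 + kc \<Longrightarrow> k + 2 * \<sigma> + 4 \<le> n"
  for \<sigma> :: nat
  by simp

text \<open>If there is exactly one big kid and no big branching below it, then the bound can only fail if
  the rest of the tree is small. Then moving the root to this kid lowers \<open>big_count\<close>.\<close>

theorem embed_rooted:
  assumes V: "is_tournament V E" and "distinct (labels t)" "2 \<le> length (labels t)"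
    and \<sigma>: "\<sigma> = (4 * length (labels t) - 3) div 14"
    and "2 * length (labels t) + 2 * \<sigma> \<le> card V + 2"
  shows "\<exists>g. inj_on g (set (labels t)) \<and> g ` set (labels t) \<subseteq> V \<and> embeds E g t"
  using assms(2-)
proof (induction "big_count \<sigma> t" arbitrary: t rule: less_induct)
  case less
  obtain a ks where t: "t = Nd a ks" by (cases t)
  let ?n = "length (labels t)"
  let ?f = "filter (\<lambda>k. big \<sigma> (snd k)) ks"
  have ks: "ks \<noteq> []" using less.prems(2) t by auto
  \<comment> \<open>The division by 14 loses at most 13, so
    \<open>14 * \<sigma> \<ge> 4n - 16\<close>.\<close>
  have \<sigma>n: "4 * ?n \<le> 14 * \<sigma> + 16" using less.prems(3) by presburger
  \<comment> \<open>By \<open>cost_sum\<close> the two costs total at most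
    \<open>2n - 2 + big_count + 2 * big_leaves\<close>, while \<open>embed_by_core\<close> admits
    \<open>card V + 3\<close>, which is at least \<open>2n + 2\<sigma> + 1\<close>.\<close>
  have fin: ?case if "big_count \<sigma> t + 2 * big_leaves \<sigma> t \<le> 2 * \<sigma> + 3"
  proof (rule embed_by_core[OF V less.prems(1,4)])
    show "cost True (core True (big \<sigma>) t) + cost False (core False (big \<sigma>) t) \<le> card V + 3"
      using cost_sum[OF ks, of \<sigma> a] that less.prems(4) unfolding t by linarith
  qed
  show ?case
  proof (cases "?f = []")
    case True
    then have "big_count \<sigma> t = 1" "big_leaves \<sigma> t = 1" unfolding t big_count.simps big_leaves.simps by simp_all
    then show ?thesis using fin by simp
  next
    case False
    then have bt: "big \<sigma> t" unfolding t by (auto simp: filter_empty_conv)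
    have n: "big_count \<sigma> t + big_leaves \<sigma> t * (\<sigma> + 2) \<le> ?n" by (rule big_count_big_leaves_le_length[OF bt])
    have lf: "length ?f \<le> big_leaves \<sigma> t"
    proof -
      have "length ?f \<le> (\<Sum>k\<leftarrow>?f. big_leaves \<sigma> (snd k))" by (rule length_filter_le_sum) (rule big_leaves_pos)
      then show ?thesis unfolding t by simp
    qed
    have k1: "1 \<le> length ?f" using False by (cases ?f) auto
    show ?thesis
    proof (cases "2 \<le> big_leaves \<sigma> t")
      case True
      then have "2 * \<sigma> \<le> big_leaves \<sigma> t * \<sigma>" by (rule mult_right_mono) simp
      then have "big_count \<sigma> t + 2 * big_leaves \<sigma> t + 2 * \<sigma> \<le> ?n" using n unfolding distrib_left by linarith
      moreover have "1 \<le> big_count \<sigma> t" unfolding t by simp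
      ultimately show ?thesis using \<sigma>n True by (intro fin) linarith
    next
      case False
      then have l1: "big_leaves \<sigma> t = 1" "length ?f = 1" using lf k1 big_leaves_pos[of \<sigma> t] by linarith+
      obtain us b c vs where c: "ks = us @ (b, c) # vs" "big \<sigma> c" "\<And>k. k \<in> set (us @ vs) \<Longrightarrow> small \<sigma> (snd k)"
        using split_at_unique_big[OF l1(2)] by blast
      \<comment> \<open>The root moves to the big kid: what remains of the old root becomes a kid,
        and the arc between them, read from its other end, has flag \<open>\<not> b\<close>.\<close>
      let ?old = "Nd a (us @ vs)"
      let ?t = "Nd (lab c) ((\<not> b, ?old) # kids c)"
      have e: "filter (\<lambda>k. big \<sigma> (snd k)) us = []" "filter (\<lambda>k. big \<sigma> (snd k)) vs = []"
        using c(3) by (auto simp: filter_empty_conv)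
      have kt: "big_count \<sigma> t = 1 + big_count \<sigma> c" unfolding t c(1) using e c(2) by simp
      obtain x cs where cN: "c = Nd x cs" by (cases c)
      show ?thesis
      proof (cases "small \<sigma> ?old")
        case True
        have mm: "mset (labels ?t) = mset (labels t)" unfolding t c(1) cN by (simp add: add_ac)
        have sm: "set (labels ?t) = set (labels t)" using mset_eq_setD[OF mm] .
        have lm: "length (labels ?t) = ?n" using mset_eq_length[OF mm] .
        have dm: "distinct (labels ?t)" using less.prems(1) mset_eq_imp_distinct_iff[OF mm] by blast
        have am: "arcs_of ?t = arcs_of t" unfolding t c(1) cN by auto
        \<comment> \<open>The small branch \<open>?old\<close> drops out of the tree of big
          branches, and the old root with it.\<close>
        have "big_count \<sigma> ?t = big_count \<sigma> c" using True unfolding cN by simp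
        then have "big_count \<sigma> ?t < big_count \<sigma> t" using kt by simp
        then have "\<exists>g. inj_on g (set (labels ?t)) \<and> g ` set (labels ?t) \<subseteq> V \<and> embeds E g ?t"
          by (rule less.hyps) (use dm lm less.prems in simp_all)
        then show ?thesis unfolding sm embeds_arcs am .
      next
        case False
        \<comment> \<open>All kids of \<open>?old\<close> are small, so a big \<open>?old\<close>
          has at least \<open>\<sigma> + 3\<close> vertices by itself. With those below the big leaf
          in \<open>c\<close>, the rest of the tree is too short to break the bound.\<close>
        then have "big_count \<sigma> ?old + big_leaves \<sigma> ?old * (\<sigma> + 2) \<le> length (labels ?old)" by (rule big_count_big_leaves_le_length)
        then have "\<sigma> + 3 \<le> length (labels ?old)" using e by simp
        moreover have "big_count \<sigma> c + 1 * (\<sigma> + 2) \<le> length (labels c)"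
          by (rule order_trans[OF add_left_mono[OF mult_right_mono[OF big_leaves_pos]] big_count_big_leaves_le_length[OF c(2)]]) simp
        moreover have "?n = length (labels ?old) + length (labels c)" unfolding t c(1) by simp
        ultimately have "big_count \<sigma> t + 2 * \<sigma> + 4 \<le> ?n" using kt by (rule reroot_arith)
        then show ?thesis using \<sigma>n l1 by (intro fin) linarith
      qed
    qed
  qed
qed

section \<open>Rooting an oriented tree\<close>

fun graft :: "'a \<Rightarrow> bool \<times> 'a rt \<Rightarrow> 'a rt \<Rightarrow> 'a rt" where
  "graft u k (Nd a ks) = Nd a ((if a = u then [k] else []) @ map (\<lambda>j. (fst j, graft u k (snd j))) ks)"

lemma lab_graft: "lab (graft u k t) = lab t" by (cases t) simp

lemma graft_notin: "u \<notin> set (labels t) \<Longrightarrow> graft u k t = t"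
proof (induction t rule: rt_induct)
  case (Nd a ks)
  have "map (\<lambda>j. (fst j, graft u k (snd j))) ks = ks"
    by (rule map_idI) (use Nd in \<open>simp add: prod_eq_iff\<close>)
  then show ?case using Nd.prems by auto
qed

lemma mset_graft:
  "distinct (labels t) \<Longrightarrow> u \<in> set (labels t) \<Longrightarrow>
   mset (labels (graft u k t)) = mset (labels t) + mset (labels (snd k))"
proof (induction t rule: rt_induct)
  case (Nd a ks)
  show ?case
  proof (cases "a = u")
    case True
    have "map (\<lambda>j. (fst j, graft u k (snd j))) ks = ks"
      by (rule map_idI) (use Nd.prems(1) True in \<open>auto simp: prod_eq_iff intro!: graft_notin\<close>)
    then show ?thesis using True by simp
  next
    case False
    then obtain j where j: "j \<in> set ks" "u \<in> set (labels (snd j))" using Nd.prems(2) by auto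
    then obtain us vs where ks: "ks = us @ j # vs" by (meson split_list)
    have no: "u \<notin> set (labels (snd i))" if "i \<in> set (us @ vs)" for i
      using Nd.prems(1) j(2) that unfolding ks by auto
    have id: "map (\<lambda>j. (fst j, graft u k (snd j))) xs = xs" if "set xs \<subseteq> set (us @ vs)" for xs
    proof (rule map_idI)
      fix j assume "j \<in> set xs"
      then have "u \<notin> set (labels (snd j))" using no that by blast
      then show "(fst j, graft u k (snd j)) = j" by (simp add: graft_notin prod_eq_iff)
    qed
    have "mset (labels (graft u k (snd j))) = mset (labels (snd j)) + mset (labels (snd k))"
      using Nd.IH[OF j(1) distinct_kid[OF Nd.prems(1) j(1)] j(2)] .
    then show ?thesis using False id[of us] id[of vs] unfolding ks by (simp add: add_ac)
  qed
qed

lemma arcs_graft: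
  "arcs_of (graft u (b, Nd v []) t) \<subseteq> insert (if b then (u, v) else (v, u)) (arcs_of t)"
proof (induction t rule: rt_induct)
  case (Nd a ks)
  let ?new = "if b then (u, v) else (v, u)"
  have "arcs_of (graft u (b, Nd v []) (Nd a ks)) \<subseteq> insert ?new (\<Union>k\<in>set ks.
      insert (if fst k then (a, lab (snd k)) else (lab (snd k), a)) (arcs_of (graft u (b, Nd v []) (snd k))))"
    by (auto simp: lab_graft)
  also have "\<dots> \<subseteq> insert ?new (\<Union>k\<in>set ks.
      insert (if fst k then (a, lab (snd k)) else (lab (snd k), a)) (insert ?new (arcs_of (snd k))))"
    by (intro insert_mono UN_mono subset_refl Nd)
  also have "\<dots> \<subseteq> insert ?new (arcs_of (Nd a ks))" unfolding arcs_of.simps by blast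
  finally show ?case .
qed

lemma arcs_reach: "x \<in> set (labels t) \<Longrightarrow> (lab t, x) \<in> (arcs_of t \<union> (arcs_of t)\<inverse>)\<^sup>*"
proof (induction t rule: rt_induct)
  case (Nd a ks)
  show ?case
  proof (cases "x = a")
    case False
    then obtain k where k: "k \<in> set ks" "x \<in> set (labels (snd k))" using Nd.prems by auto
    let ?R = "\<lambda>t. arcs_of t \<union> (arcs_of t)\<inverse>"
    have sub: "insert (if fst k then (a, lab (snd k)) else (lab (snd k), a)) (arcs_of (snd k)) \<subseteq> arcs_of (Nd a ks)"
      unfolding arcs_of.simps using k(1) by (rule UN_upper)
    then have "(?R (snd k))\<^sup>* \<subseteq> (?R (Nd a ks))\<^sup>*" by (intro rtrancl_mono) blast
    then have "(lab (snd k), x) \<in> (?R (Nd a ks))\<^sup>*" using Nd.IH[OF k] by blast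
    moreover have "(a, lab (snd k)) \<in> ?R (Nd a ks)" using sub by (cases "fst k") simp_all
    ultimately show ?thesis by (simp add: converse_rtrancl_into_rtrancl)
  qed simp
qed

text \<open>Take a largest rooted tree with arcs in \<open>R\<close>. If it missed a vertex, some
  arc of \<open>R\<close> would leave its vertex set, and \<open>graft\<close> would add the other
  end as a new leaf.\<close>

lemma spanning_rooted_tree:
  assumes V: "finite V" "a \<in> V" and R: "R \<subseteq> V \<times> V" and conn: "\<And>v. v \<in> V \<Longrightarrow> (a, v) \<in> (R \<union> R\<inverse>)\<^sup>*"
  obtains t where "distinct (labels t)" "set (labels t) = V" "arcs_of t \<subseteq> R"
proof -
  let ?Q = "\<lambda>t. distinct (labels t) \<and> a \<in> set (labels t) \<and> set (labels t) \<subseteq> V \<and> arcs_of t \<subseteq> R"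
  have Q0: "?Q (Nd a [])" using V by simp
  have bd: "\<forall>t. ?Q t \<longrightarrow> length (labels t) < Suc (card V)"
    using V(1) by (metis card_mono distinct_card less_Suc_eq_le)
  obtain t where t: "?Q t" and mx: "\<And>t'. ?Q t' \<Longrightarrow> length (labels t') \<le> length (labels t)"
    using ex_has_greatest_nat[of ?Q "Nd a []" "\<lambda>t. length (labels t)", OF Q0 bd] by blast
  let ?S = "set (labels t)"
  have step: "w \<in> ?S" if s: "u \<in> ?S" "(u, w) \<in> R \<union> R\<inverse>" for u w
  proof (rule ccontr)
    assume w: "w \<notin> ?S"
    define b where "b \<longleftrightarrow> (u, w) \<in> R"
    let ?t = "graft u (b, Nd w []) t"
    have ms: "mset (labels ?t) = mset (labels t @ [w])" using mset_graft[of t u "(b, Nd w [])"] t s by simp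
    have "arcs_of ?t \<subseteq> insert (if b then (u, w) else (w, u)) (arcs_of t)" by (rule arcs_graft)
    also have "\<dots> \<subseteq> R" using t s(2) by (auto simp: b_def)
    finally have "arcs_of ?t \<subseteq> R" .
    moreover have "distinct (labels ?t)" using mset_eq_imp_distinct_iff[OF ms] t w by simp
    moreover have "w \<in> V" using s(2) R by blast
    moreover have "set (labels ?t) = insert w ?S" using mset_eq_setD[OF ms] by simp
    ultimately have "length (labels ?t) \<le> length (labels t)" using t by (intro mx) auto
    then show False using mset_eq_length[OF ms] by simp
  qed
  have "v \<in> ?S" if v: "v \<in> V" for v
    using conn[OF v]
  proof (induction rule: rtrancl_induct)
    case base
    show ?case using t by blast
  next
    case (step y z)
    then show ?case using \<open>\<And>w u. u \<in> ?S \<Longrightarrow> (u, w) \<in> R \<union> R\<inverse> \<Longrightarrow> w \<in> ?S\<close> by blast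
  qed
  then have "?S = V" using t by blast
  then show thesis using that t by blast
qed

text \<open>The ends of an arc are read off the pair itself, whatever the digraph. So a path of the
  spanning tree is also one in the whole graph.\<close>

lemma cas_with_proj: "pre_digraph.cas (with_proj H) u p v = pre_digraph.cas (with_proj G) u p v"
  by (induction p arbitrary: u) (simp_all add: pre_digraph.cas.simps)

text \<open>An arc outside a spanning tree closes a cycle with the path of the tree between its ends.\<close>

lemma oriented_tree_rooted:
  assumes "oriented_tree A"
  obtains t where "distinct (labels t)" "set (labels t) = pverts A" "parcs A \<subseteq> arcs_of t"
proof -
  obtain G where G: "pair_graph G" "connected (with_proj G)"
      and acyc: "\<And>p. pre_digraph.cycle (with_proj G) p \<Longrightarrow> \<not> 3 \<le> length p"
      and A: "pair_digraph A" "\<And>u v. (u, v) \<in> parcs A \<Longrightarrow> (v, u) \<notin> parcs A"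
      and AG: "mk_symmetric (with_proj A) = G"
    using assms unfolding oriented_tree_def undirected_tree_def orientation_def by blast
  interpret A: pair_digraph A by (rule A(1))
  interpret G: pair_graph G by (rule G(1))
  have VG: "pverts G = pverts A" unfolding AG[symmetric] by simp
  have EG: "parcs G = parcs A \<union> (parcs A)\<inverse>" unfolding AG[symmetric] parcs_mk_symmetric by force
  have EGG: "arcs_ends (with_proj (mk_symmetric (with_proj G))) = parcs A \<union> (parcs A)\<inverse>"
    by (auto simp: parcs_mk_symmetric EG)
  have sc: "strongly_connected (with_proj (mk_symmetric (with_proj G)))" using G(2) by (simp add: connected_def)
  then obtain a where a: "a \<in> pverts A" unfolding strongly_connected_def by (auto simp: VG)
  have "(a, v) \<in> (parcs A \<union> (parcs A)\<inverse>)\<^sup>*" if "v \<in> pverts A" for v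
    unfolding EGG[symmetric]
    by (rule reachable_rtranclI) (use sc a that in \<open>auto simp: strongly_connected_def VG\<close>)
  moreover have "parcs A \<subseteq> pverts A \<times> pverts A" using A.in_arcsD1 A.in_arcsD2 by auto
  ultimately obtain t where t: "distinct (labels t)" "set (labels t) = pverts A" "arcs_of t \<subseteq> parcs A"
    using spanning_rooted_tree[of "pverts A" a "parcs A"] a A.finite_verts by auto
  \<comment> \<open>The tree arcs are taken in both directions, since the path from \<open>v\<close>
    back to \<open>u\<close> may run against them.\<close>
  define H where "H = \<lparr>pverts = pverts A, parcs = arcs_of t \<union> (arcs_of t)\<inverse>\<rparr>"
  have HG: "parcs H \<subseteq> parcs G" "pverts H = pverts G" using t(3) by (auto simp: H_def EG VG)
  have "parcs G \<subseteq> pverts G \<times> pverts G" using G.in_arcsD1 G.in_arcsD2 by auto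
  then have HV: "parcs H \<subseteq> pverts H \<times> pverts H" using HG by simp
  interpret H: pair_wf_digraph H by unfold_locales (use HV in auto)
  have "(u, v) \<in> arcs_of t" if uv: "(u, v) \<in> parcs A" for u v
  proof -
    have V: "u \<in> pverts A" "v \<in> pverts A" using uv A.in_arcsD1 A.in_arcsD2 by auto
    have ne: "u \<noteq> v" using A(2)[OF uv] uv by blast
    have sy: "sym ((parcs H)\<^sup>*)" by (intro sym_rtrancl) (auto simp: sym_def H_def)
    have "(lab t, x) \<in> (parcs H)\<^sup>*" if "x \<in> pverts A" for x
      using arcs_reach[of x t] that t(2) by (simp add: H_def)
    then have "(v, u) \<in> (parcs H)\<^sup>*" using V symD[OF sy] by (meson rtrancl_trans)
    then have "v \<rightarrow>\<^sup>*\<^bsub>with_proj H\<^esub> u"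
    proof (induction rule: rtrancl_induct)
      case base
      show ?case by (rule H.reachable_refl) (simp add: H_def V)
    next
      case (step y z)
      show ?case by (rule H.reachable_adj_trans[OF step.IH]) (use step.hyps in simp)
    qed
    then obtain p where p: "pre_digraph.apath (with_proj H) v p u" unfolding H.reachable_apath ..
    then have w: "pre_digraph.awalk (with_proj H) v p u" and d: "distinct (pre_digraph.awalk_verts (with_proj H) v p)"
      by (auto simp: H.apath_def)
    have "pre_digraph.awalk (with_proj G) v p u"
      using w HG unfolding pre_digraph.awalk_def cas_with_proj[of H v p u G] by auto
    then have "pre_digraph.awalk (with_proj G) u ((u, v) # p) u"
      using uv unfolding G.awalk_Cons_iff by (simp add: EG)
    moreover have "distinct (tl (pre_digraph.awalk_verts (with_proj G) u ((u, v) # p)))"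
      using d by (simp add: pre_digraph.awalk_verts_conv)
    ultimately have "pre_digraph.cycle (with_proj G) ((u, v) # p)" unfolding pre_digraph.cycle_def by blast
    \<comment> \<open>The arc \<open>(u, v)\<close> followed by \<open>p\<close> is a cycle, so its
      length is below 3. Hence \<open>p\<close> is the single opposite arc, and the edge already
      belongs to the spanning tree.\<close>
    then have "length p < 2" using acyc by fastforce
    moreover have "p \<noteq> []" using w ne by (auto simp: H.awalk_Nil_iff)
    ultimately obtain e where "p = [e]" by (cases p) auto
    then have "e = (v, u)" "e \<in> parcs H" using w by (auto simp: H.awalk_simps prod_eq_iff)
    then have "(v, u) \<in> arcs_of t \<or> (u, v) \<in> arcs_of t" by (auto simp: H_def)
    then show ?thesis using A(2)[OF uv] t(3) by blast
  qed
  then have "parcs A \<subseteq> arcs_of t" by auto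
  from t(1,2) this show thesis by (rule that)
qed

theorem theorem1:
  fixes A :: "'a pair_pre_digraph" and n :: nat
  assumes "n \<ge> 2"
    and "oriented_tree A"
    and "card (pverts A) = n"
  shows "int (unvd A) \<le> \<lceil>(18 * real n - 23) / 7\<rceil>"
proof -
  define \<sigma> where "\<sigma> = (4 * n - 3) div 14"
  define m where "m = 2 * n - 2 + 2 * \<sigma>"
  obtain t where t: "distinct (labels t)" "set (labels t) = pverts A" "parcs A \<subseteq> arcs_of t"
    using oriented_tree_rooted[OF assms(2)] .
  have len: "length (labels t) = n" using distinct_card[OF t(1)] t(2) assms(3) by simp
  have "pair_digraph A" using assms(2) by (auto simp: oriented_tree_def orientation_def)
  then interpret A: pair_digraph A .
  have A: "pair_wf_digraph A" by unfold_locales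
  have "unavoidable m A"
    unfolding unavoidable_def
  proof (intro allI impI)
    fix T :: "nat pair_pre_digraph" assume "tournament m T"
    then have T: "finite (pverts T)" "card (pverts T) = m" "parcs T \<subseteq> pverts T \<times> pverts T"
      "\<forall>u. (u, u) \<notin> parcs T"
      "\<forall>u\<in>pverts T. \<forall>v\<in>pverts T. u \<noteq> v \<longrightarrow> ((u, v) \<in> parcs T \<longleftrightarrow> (v, u) \<notin> parcs T)"
      unfolding tournament_iff by - (elim conjE, assumption)+
    have "is_tournament (pverts T) (\<lambda>u v. (u, v) \<in> parcs T)"
      unfolding is_tournament_def
    proof (intro conjI ballI impI)
      fix u v assume uv: "u \<in> pverts T" "v \<in> pverts T"
      show "(v, u) \<notin> parcs T" if "(u, v) \<in> parcs T" using T(4,5) uv that by metis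
      show "(u, v) \<in> parcs T \<or> (v, u) \<in> parcs T" if "u \<noteq> v" using T(5) uv that by metis
    qed (rule T(1))
    moreover have "2 * length (labels t) + 2 * \<sigma> \<le> card (pverts T) + 2"
      using assms(1) unfolding len T(2) m_def by linarith
    ultimately obtain g where g: "inj_on g (pverts A)" "g ` pverts A \<subseteq> pverts T"
        "embeds (\<lambda>u v. (u, v) \<in> parcs T) g t"
      using embed_rooted[of "pverts T" "\<lambda>u v. (u, v) \<in> parcs T" t \<sigma>] t(1,2) len assms(1) \<sigma>_def by auto
    have "pair_wf_digraph T" using T(3) by unfold_locales auto
    moreover have "(g u, g v) \<in> parcs T" if "(u, v) \<in> parcs A" for u v
      using g(3) t(3) that unfolding embeds_arcs by blast
    ultimately show "contains_copy T A" using g(1,2) contains_copy_iff[OF A] by blast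
  qed
  then have "unvd A \<le> m" unfolding unvd_def by (rule Least_le)
  then have "int (unvd A) \<le> 2 * int n - 2 + 2 * int \<sigma>" using assms(1) unfolding m_def by linarith
  moreover have "14 * \<sigma> + 3 \<le> 4 * n" using assms(1) unfolding \<sigma>_def by presburger
  then have "real (14 * \<sigma> + 3) \<le> real (4 * n)" by (rule of_nat_mono)
  \<comment> \<open>An integer is at most the ceiling of \<open>x\<close> iff it is less than
    \<open>x + 1\<close>; here this reads \<open>14 * \<sigma> + 2 < 4n\<close>.\<close>
  then have "2 * int n - 2 + 2 * int \<sigma> \<le> \<lceil>(18 * real n - 23) / 7\<rceil>" by (simp add: le_ceiling_iff)
  ultimately show ?thesis by linarith
qed

end
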